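(* Consider the Liouville transformation $$\tau=t,\qquad y=\int^x\rho(t,\xi)\,d\xi,\qquad P(\tau,y)=-m(t,x)\,\rho(t,x)^{-2},$$ $$Q(\tau,y)=-\tfrac14\rho^{-2}+\tfrac34\rho^{-4}\rho_x^2-\tfrac12\rho^{-3}\rho_{xx}.$$ Under this transformation, for each integer $n\in\mathbb Z$, the equation (2CH)$_{n+1}$ of the two-component Camassa-Holm hierarchy is mapped into the equation (A2CH)$_{-n}$ of the associated two-component Camassa-Holm hierarchy; that is, if $(m(t,x),\rho(t,x))$ solves (2CH)$_{n+1}$, then the corresponding $(Q(\tau,y),P(\tau,y))$ solves (A2CH)$_{-n}$.
   Context: Conventions. All operators are formal matrix (pseudo-)differential operators; inverses such as $\partial_x^{-1},\partial_y^{-1},\mathcal J^{-1},\mathcal K^{-1}$ are formal, and equations involving them are understood up to a suitable choice of integration constants (in particular the integration constant, possibly time-dependent, in $y=\int^x\rho\,d\xi$). Operators in $x$ and $y$ are related by $\partial_x=\rho\,\partial_y$. 2CH hierarchy. Let $$\mathcal K=\begin{pmatrix} m\partial_x+\partial_x m&\rho\partial_x\\ \partial_x\rho&0\end{pmatrix},\qquad \mathcal J=\begin{pmatrix}\partial_x-\partial_x^3&0\\0&\partial_x\end{pmatrix}.$$ The hierarchy is $(m,\rho)^T_t=\mathbf K_n$, $n\in\mathbb Z$, and the equation with index $n$ is called (2CH)$_n$. The positive flows are $\mathbf K_n=(\mathcal K\mathcal J^{-1})^{n-1}\mathbf K_1$, $n\ge1$, with $\mathbf K_1=-(m_x,\rho_x)^T$;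 $\mathbf K_2$ gives the 2CH system $m_t+2u_xm+um_x+\rho\rho_x=0$, $\rho_t+(\rho u)_x=0$, $m=u-u_{xx}$. Also $\mathbf K_0=(0,0)^T$. The negative flows are $\mathbf K_{-n}=(\mathcal J\mathcal K^{-1})^{n-1}\mathcal J\,(\rho^{-1},\,-m\rho^{-2})^T$, $n\ge1$. A2CH hierarchy. Let $$\overline{\mathcal R}=\frac12\begin{pmatrix}0&\partial_y^2+4Q+2Q_y\partial_y^{-1}\\-4&4P+2P_y\partial_y^{-1}\end{pmatrix},\qquad \overline{\mathbf K}_1=(-Q_y,-P_y)^T.$$ For $n\ge1$, (A2CH)$_n$ is $(Q,P)^T_\tau=\overline{\mathcal R}^{\,n-1}\overline{\mathbf K}_1$, and (A2CH)$_{-n}$ is $\overline{\mathcal R}^{\,n}(Q,P)^T_\tau=(0,0)^T$; (A2CH)$_0$ is the trivial flow $(Q,P)^T_\tau=(0,0)^T$. *)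

theory Defs
  imports "HOL-Analysis.Analysis"
begin

type_synonym field = "real \<times> real \<Rightarrow> real"

text \<open>Columns \<open>(f, g)\<^sup>T\<close> of two scalar fields.\<close>

type_synonym vfield = "field \<times> field"

text \<open>Partial derivatives in the first (time) and second (space) variable.
  On the domain of \<open>(m, \<rho>)\<close> they are \<open>\<partial>\<^sub>t\<close>, \<open>\<partial>\<^sub>x\<close>; on the domain of \<open>(Q, P)\<close> they
  are \<open>\<partial>\<^sub>\<tau>\<close>, \<open>\<partial>\<^sub>y\<close>.\<close>

definition D1 :: "field \<Rightarrow> field" where
  "D1 f = (\<lambda>(t, x). deriv (\<lambda>s. f (s, x)) t)"

definition D2 :: "field \<Rightarrow> field" where
  "D2 f = (\<lambda>(t, x). deriv (\<lambda>z. f (t, z)) x)"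

text \<open>Joint \<open>C\<^sup>k\<close> and \<open>C\<^sup>\<infinity>\<close> smoothness; only meant for open \<open>S\<close>.\<close>

primrec Ck_on :: "nat \<Rightarrow> (real \<times> real) set \<Rightarrow> field \<Rightarrow> bool" where
  "Ck_on 0 S f \<longleftrightarrow> continuous_on S f"
| "Ck_on (Suc k) S f \<longleftrightarrow> f differentiable_on S \<and> Ck_on k S (D1 f) \<and> Ck_on k S (D2 f)"

definition smooth_on :: "(real \<times> real) set \<Rightarrow> field \<Rightarrow> bool" where
  "smooth_on S f \<longleftrightarrow> (\<forall>k. Ck_on k S f)"

text \<open>Fields are total functions, but only their values on the domain \<open>S\<close> matter.\<close>

definition eq_on :: "(real \<times> real) set \<Rightarrow> vfield \<Rightarrow> vfield \<Rightarrow> bool" where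
  "eq_on S v w \<longleftrightarrow> (\<forall>p\<in>S. fst v p = fst w p \<and> snd v p = snd w p)"

text \<open>Formal operators are treated as relations between columns. The inverse of a differential
  operator is the converse of its graph on smooth columns, so that an inverse is determined
  exactly up to integration constants, which may depend smoothly on time.
  Note that \<open>r O s\<close> applies \<open>r\<close> first.\<close>

definition op_graph :: "(real \<times> real) set \<Rightarrow> (vfield \<Rightarrow> vfield) \<Rightarrow> (vfield \<times> vfield) set" where
  "op_graph S L = {(v, w). smooth_on S (fst v) \<and> smooth_on S (snd v) \<and> eq_on S w (L v)}"

fun K_op :: "field \<Rightarrow> field \<Rightarrow> vfield \<Rightarrow> vfield" where
  "K_op m \<rho> (a, b) =
    (\<lambda>p. (m p * D2 a p + D2 (\<lambda>q. m q * a q) p) + \<rho> p * D2 b p,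
     \<lambda>p. D2 (\<lambda>q. \<rho> q * a q) p)"

fun J_op :: "vfield \<Rightarrow> vfield" where
  "J_op (a, b) = (\<lambda>p. D2 a p - D2 (D2 (D2 a)) p, \<lambda>p. D2 b p)"

text \<open>The relational operators \<open>\<K> \<J>\<^sup>-\<^sup>1\<close> and \<open>\<J> \<K>\<^sup>-\<^sup>1\<close>.\<close>

definition KJinv :: "(real \<times> real) set \<Rightarrow> field \<Rightarrow> field \<Rightarrow> (vfield \<times> vfield) set" where
  "KJinv S m \<rho> = (op_graph S J_op)\<inverse> O op_graph S (K_op m \<rho>)"

definition JKinv :: "(real \<times> real) set \<Rightarrow> field \<Rightarrow> field \<Rightarrow> (vfield \<times> vfield) set" where
  "JKinv S m \<rho> = (op_graph S (K_op m \<rho>))\<inverse> O op_graph S J_op"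

text \<open>All admissible right-hand sides \<open>\<^bold>K\<^sub>n\<close>, one for each choice of integration constants.\<close>

definition flow_2CH ::
  "(real \<times> real) set \<Rightarrow> int \<Rightarrow> field \<Rightarrow> field \<Rightarrow> vfield set" where
  "flow_2CH S n m \<rho> =
    (if n \<ge> 1 then
       (KJinv S m \<rho> ^^ nat (n - 1)) `` {(\<lambda>p. - D2 m p, \<lambda>p. - D2 \<rho> p)}
     else if n = 0 then {(\<lambda>p. 0, \<lambda>p. 0)}
     else
       (JKinv S m \<rho> ^^ nat (- n - 1)) ``
         {J_op (\<lambda>p. 1 / \<rho> p, \<lambda>p. - m p / (\<rho> p)\<^sup>2)})"

definition solves_2CH ::
  "(real \<times> real) set \<Rightarrow> int \<Rightarrow> field \<Rightarrow> field \<Rightarrow> bool" where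
  "solves_2CH S n m \<rho> \<longleftrightarrow>
    open S \<and> smooth_on S m \<and> smooth_on S \<rho> \<and> (\<forall>p\<in>S. \<rho> p \<noteq> 0) \<and>
    (\<exists>F\<in>flow_2CH S n m \<rho>. eq_on S (D1 m, D1 \<rho>) F)"

text \<open>The relational operator \<open>\<R>\<close> of the associated hierarchy; \<open>\<beta>\<close> stands for \<open>\<partial>\<^sub>y\<^sup>-\<^sup>1 b\<close>, and the
  same antiderivative is used in both rows.\<close>

definition Rbar :: "(real \<times> real) set \<Rightarrow> field \<Rightarrow> field \<Rightarrow> (vfield \<times> vfield) set" where
  "Rbar S Q P = {((a, b), w). \<exists>\<beta>. smooth_on S \<beta> \<and> (\<forall>p\<in>S. D2 \<beta> p = b p) \<and>
     eq_on S w
       (\<lambda>p. 1/2 * (D2 (D2 b) p + 4 * Q p * b p + 2 * D2 Q p * \<beta> p),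
        \<lambda>p. 1/2 * (- 4 * a p + (4 * P p * b p + 2 * D2 P p * \<beta> p)))}"

definition solves_A2CH ::
  "(real \<times> real) set \<Rightarrow> int \<Rightarrow> field \<Rightarrow> field \<Rightarrow> bool" where
  "solves_A2CH S n Q P \<longleftrightarrow>
    open S \<and> smooth_on S Q \<and> smooth_on S P \<and>
    (if n \<ge> 1 then
       (\<exists>F \<in> (Rbar S Q P ^^ nat (n - 1)) `` {(\<lambda>p. - D2 Q p, \<lambda>p. - D2 P p)}.
          eq_on S (D1 Q, D1 P) F)
     else
       (\<exists>F \<in> (Rbar S Q P ^^ nat (- n)) `` {(D1 Q, D1 P)}.
          eq_on S F (\<lambda>p. 0, \<lambda>p. 0)))"

text \<open>\<open>y = \<integral>\<^sup>x \<rho> d\<xi>\<close>: an antiderivative of \<open>\<rho>\<close> in \<open>x\<close>, determined up to adding a function of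
  \<open>t\<close> (when the time slices of \<open>S\<close> are intervals).\<close>

definition liouville_coord :: "(real \<times> real) set \<Rightarrow> field \<Rightarrow> field \<Rightarrow> bool" where
  "liouville_coord S \<rho> y \<longleftrightarrow> smooth_on S y \<and>
    (\<forall>(t, x)\<in>S. ((\<lambda>\<xi>. y (t, \<xi>)) has_real_derivative \<rho> (t, x)) (at x))"

definition liouville_map :: "field \<Rightarrow> real \<times> real \<Rightarrow> real \<times> real" where
  "liouville_map y = (\<lambda>(t, x). (t, y (t, x)))"

text \<open>These equations fix \<open>Q\<close> and \<open>P\<close> on the image of \<open>S\<close>.\<close>

definition liouville_transform ::
  "(real \<times> real) set \<Rightarrow> field \<Rightarrow> field \<Rightarrow> field \<Rightarrow> field \<Rightarrow> field \<Rightarrow> bool" where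
  "liouville_transform S m \<rho> y Q P \<longleftrightarrow>
    liouville_coord S \<rho> y \<and>
    (\<forall>p\<in>S.
       P (liouville_map y p) = - m p / (\<rho> p)\<^sup>2 \<and>
       Q (liouville_map y p) =
         - (1/4) / (\<rho> p)^2 + 3/4 * (D2 \<rho> p)^2 / (\<rho> p)^4 - 1/2 * D2 (D2 \<rho>) p / (\<rho> p)^3)"

end

theory Submission
  imports Defs
begin

text \<open>Suppose \<open>(m, \<rho>)\<^sub>t = \<K> (a, b)\<^sup>T\<close>, and fix the integration constant in \<open>y\<close> so that
  \<open>y\<^sub>t = \<rho> a\<close>. With \<open>M = diag (1 / (2 \<rho>\<^sup>2), - 1 / \<rho>)\<close> one computes
  \<open>(Q, P)\<^sub>\<tau> = M \<J> (a, b)\<^sup>T\<close>; the first row is the covariance of the Schwarzian derivative.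
  The same computation gives the intertwining relation \<open>\<R> M \<K> = M \<J>\<close>, that is,
  \<open>M\<close> carries the relation \<open>\<J> \<K>\<^sup>-\<^sup>1\<close> into \<open>\<R>\<close>. The positive flows end at
  \<open>\<J> (-1, 0)\<^sup>T = 0\<close>, since \<open>\<K> (-1, 0)\<^sup>T = \<^bold>K\<^sub>1\<close>. The others start from the kernel element
  \<open>c = (1 / \<rho>, P)\<^sup>T\<close> of \<open>\<K>\<close>, for which \<open>M \<J> c = (- Q\<^sub>y, - P\<^sub>y)\<^sup>T\<close>.\<close>

section \<open>Smooth fields\<close>

lemma D2_deriv: "D2 f (t, x) = deriv (\<lambda>z. f (t, z)) x"
  and D1_deriv: "D1 f (t, x) = deriv (\<lambda>s. f (s, x)) t"
  by (simp_all add: D1_def D2_def)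

lemma D2_eqI:
  assumes "((\<lambda>z. f (t, z)) has_real_derivative d) (at x)"
  shows "D2 f (t, x) = d"
  using assms by (simp add: D2_deriv DERIV_imp_deriv)

lemma D1_eqI:
  assumes "((\<lambda>s. f (s, x)) has_real_derivative d) (at t)"
  shows "D1 f (t, x) = d"
  using assms by (simp add: D1_deriv DERIV_imp_deriv)

lemma partial_has_real_derivative:
  fixes f :: field
  assumes "(f has_derivative L) (at (t, x))"
  shows "((\<lambda>s. f (s, x)) has_real_derivative L (1, 0)) (at t)"
    and "((\<lambda>z. f (t, z)) has_real_derivative L (0, 1)) (at x)"
proof -
  interpret bounded_linear L using assms by (rule has_derivative_bounded_linear)
  have "((\<lambda>s. f (s, x)) has_derivative (\<lambda>h. L (h, 0))) (at t)"
    by (rule has_derivative_compose[where g = f and f = "\<lambda>s. (s, x)", OF _ assms])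
      (auto intro!: derivative_eq_intros)
  moreover have "(\<lambda>h. L (h, 0)) = (*) (L (1, 0))"
  proof
    show "L (h, 0) = L (1, 0) * h" for h using scaleR[of h "(1, 0)"] by simp
  qed
  ultimately show "((\<lambda>s. f (s, x)) has_real_derivative L (1, 0)) (at t)"
    unfolding has_field_derivative_def by metis
  have "((\<lambda>z. f (t, z)) has_derivative (\<lambda>h. L (0, h))) (at x)"
    by (rule has_derivative_compose[where g = f and f = "\<lambda>z. (t, z)", OF _ assms])
      (auto intro!: derivative_eq_intros)
  moreover have "(\<lambda>h. L (0, h)) = (*) (L (0, 1))"
  proof
    show "L (0, h) = L (0, 1) * h" for h using scaleR[of h "(0, 1)"] by simp
  qed
  ultimately show "((\<lambda>z. f (t, z)) has_real_derivative L (0, 1)) (at x)"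
    unfolding has_field_derivative_def by metis
qed

lemma has_derivative_partials:
  assumes "f differentiable_on S" "open S" "p \<in> S"
  shows "(f has_derivative (\<lambda>h. D1 f p * fst h + D2 f p * snd h)) (at p)"
proof -
  obtain t x where p: "p = (t, x)" by (cases p)
  from assms obtain L where L: "(f has_derivative L) (at p)"
    by (metis at_within_open differentiable_def differentiable_on_def)
  interpret bounded_linear L using L by (rule has_derivative_bounded_linear)
  have "L h = D1 f p * fst h + D2 f p * snd h" for h
    using add[of "(fst h, 0)" "(0, snd h)"] scaleR[of "fst h" "(1, 0)"] scaleR[of "snd h" "(0, 1)"]
      D1_eqI[OF partial_has_real_derivative(1)[OF L[unfolded p]]]
      D2_eqI[OF partial_has_real_derivative(2)[OF L[unfolded p]]]
    by (simp add: p)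
  then have "L = (\<lambda>h. D1 f p * fst h + D2 f p * snd h)" by (rule ext)
  with L show ?thesis by (simp only:)
qed

lemma partials_eqI:
  assumes "(f has_derivative L) (at p)"
  shows "D1 f p = L (1, 0)" "D2 f p = L (0, 1)"
  using assms partial_has_real_derivative[of f L "fst p" "snd p"]
    D1_eqI[of f "snd p" _ "fst p"] D2_eqI[of f "fst p" _ "snd p"] by auto

text \<open>An open box around \<open>p\<close> lies in \<open>S\<close>, so the axis-parallel
  slices of \<open>f\<close> and \<open>g\<close> agree near \<open>p\<close>. This justifies
  replacing a field by one that agrees with it on \<open>S\<close> only.\<close>

lemma D_cong:
  assumes "open S" "p \<in> S" "\<And>q. q \<in> S \<Longrightarrow> f q = g q"
  shows "D1 f p = D1 g p" "D2 f p = D2 g p"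
proof -
  obtain t x where p: "p = (t, x)" by (cases p)
  obtain U V where UV: "open U" "open V" "t \<in> U" "x \<in> V" "U \<times> V \<subseteq> S"
    using open_prod_elim[OF assms(1,2)] unfolding p by (metis mem_Sigma_iff)
  have "eventually (\<lambda>s. s \<in> U) (nhds t)" "eventually (\<lambda>z. z \<in> V) (nhds x)"
    using UV by (auto simp: eventually_nhds)
  then have "eventually (\<lambda>s. f (s, x) = g (s, x)) (nhds t)" "eventually (\<lambda>z. f (t, z) = g (t, z)) (nhds x)"
    using UV assms(3) by (auto elim!: eventually_mono)
  then show "D1 f p = D1 g p" "D2 f p = D2 g p"
    by (auto simp: p D1_deriv D2_deriv intro!: deriv_cong_ev)
qed

lemma Ck_on_cong:
  assumes "open S" "Ck_on k S f" "\<And>q. q \<in> S \<Longrightarrow> f q = g q"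
  shows "Ck_on k S g"
  using assms(2,3)
proof (induction k arbitrary: f g)
  case 0
  then show ?case by (auto cong: continuous_on_cong)
next
  case (Suc k)
  have "g differentiable_on S"
    unfolding differentiable_on_def
  proof
    fix q assume "q \<in> S"
    with Suc.prems show "g differentiable at q within S"
      by (intro differentiable_transform_within[of f q S 1 g]) (auto simp: differentiable_on_def)
  qed
  moreover have "Ck_on k S (D1 g)" "Ck_on k S (D2 g)"
    using Suc.IH[of "D1 f" "D1 g"] Suc.IH[of "D2 f" "D2 g"] Suc.prems D_cong[OF assms(1), of _ f g]
    by auto
  ultimately show ?case by simp
qed

lemma Ck_on_Suc_imp: "Ck_on (Suc k) S f \<Longrightarrow> Ck_on k S f"
proof (induction k arbitrary: f)
  case 0
  then show ?case by (simp add: differentiable_imp_continuous_on)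
next
  case (Suc k)
  from Suc.prems have "f differentiable_on S" "Ck_on (Suc k) S (D1 f)" "Ck_on (Suc k) S (D2 f)"
    unfolding Ck_on.simps(2)[of "Suc k"] by blast+
  with Suc.IH show ?case unfolding Ck_on.simps(2)[of k] by blast
qed

lemma smooth_on_continuous: "smooth_on S f \<Longrightarrow> continuous_on S f"
  unfolding smooth_on_def using Ck_on.simps(1) by blast

text \<open>Since \<open>C^(k+1)\<close> implies \<open>C^k\<close>, quantifying over successors
  alone loses nothing. The resulting fixed-point form gives smoothness of the partials at
  once.\<close>

lemma smooth_on_unfold:
  "smooth_on S f \<longleftrightarrow> f differentiable_on S \<and> smooth_on S (D1 f) \<and> smooth_on S (D2 f)"
proof -
  have "smooth_on S f \<longleftrightarrow> (\<forall>k. Ck_on (Suc k) S f)"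
    unfolding smooth_on_def using Ck_on_Suc_imp by blast
  then show ?thesis by (auto simp: smooth_on_def)
qed

lemma smooth_on_D [intro]: "smooth_on S f \<Longrightarrow> smooth_on S (D1 f)" "smooth_on S f \<Longrightarrow> smooth_on S (D2 f)"
  using smooth_on_unfold by blast+

lemma smooth_on_has_derivative:
  assumes "smooth_on S f" "open S" "p \<in> S"
  shows "(f has_derivative (\<lambda>h. D1 f p * fst h + D2 f p * snd h)) (at p)"
  using assms has_derivative_partials smooth_on_unfold by blast

lemma smooth_on_has_partials:
  assumes "smooth_on S f" "open S" "(t, x) \<in> S"
  shows "((\<lambda>s. f (s, x)) has_real_derivative D1 f (t, x)) (at t)"
    and "((\<lambda>z. f (t, z)) has_real_derivative D2 f (t, x)) (at x)"
  using partial_has_real_derivative[OF smooth_on_has_derivative[OF assms]] by simp_all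

lemma Ck_on_const: "Ck_on k S (\<lambda>p. c)"
proof (induction k arbitrary: c)
  case (Suc k)
  have "D1 (\<lambda>p. c) = (\<lambda>p. 0)" "D2 (\<lambda>p. c) = (\<lambda>p. 0)"
    by (auto simp: D1_def D2_def)
  with Suc show ?case by simp
qed simp

text \<open>The candidate partials \<open>f1\<close>, \<open>f2\<close> are meaningful on
  \<open>S\<close> only. The total derivative identifies them there with \<open>D1 f\<close>,
  \<open>D2 f\<close>, and \<open>Ck_on_cong\<close> transfers the regularity.\<close>

lemma Ck_on_SucI:
  assumes "open S" "\<And>p. p \<in> S \<Longrightarrow> (f has_derivative (\<lambda>h. f1 p * fst h + f2 p * snd h)) (at p)"
    and "Ck_on k S f1" "Ck_on k S f2"
  shows "Ck_on (Suc k) S f"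
proof -
  have "f differentiable_on S"
    using assms(1,2) by (meson differentiable_def differentiable_at_withinI differentiable_on_def)
  moreover have "Ck_on k S (D1 f)" "Ck_on k S (D2 f)"
    using Ck_on_cong[OF assms(1,3), of "D1 f"] Ck_on_cong[OF assms(1,4), of "D2 f"]
      partials_eqI[OF assms(2)] by auto
  ultimately show ?thesis by simp
qed

lemma Ck_on_Suc_has_derivative:
  assumes "Ck_on (Suc k) S f" "open S" "p \<in> S"
  shows "(f has_derivative (\<lambda>h. D1 f p * fst h + D2 f p * snd h)) (at p)"
  using assms(1) has_derivative_partials[OF _ assms(2,3)] unfolding Ck_on.simps by blast

lemma Ck_on_add:
  assumes "open S" "Ck_on k S f" "Ck_on k S g"
  shows "Ck_on k S (\<lambda>p. f p + g p)"
  using assms(2,3)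
proof (induction k arbitrary: f g)
  case 0
  then show ?case by (auto intro: continuous_on_add)
next
  case (Suc k)
  show ?case
  proof (rule Ck_on_SucI[OF assms(1)])
    fix p assume p: "p \<in> S"
    show "((\<lambda>p. f p + g p) has_derivative
      (\<lambda>h. (D1 f p + D1 g p) * fst h + (D2 f p + D2 g p) * snd h)) (at p)"
      by (rule has_derivative_eq_rhs[OF has_derivative_add[OF
            Suc.prems[THEN Ck_on_Suc_has_derivative[OF _ assms(1) p]]]])
        (simp add: algebra_simps)
  qed (use Suc in auto)
qed

lemma Ck_on_mult:
  assumes "open S" "Ck_on k S f" "Ck_on k S g"
  shows "Ck_on k S (\<lambda>p. f p * g p)"
  using assms(2,3)
proof (induction k arbitrary: f g)
  case 0
  then show ?case by (auto intro: continuous_on_mult)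
next
  case (Suc k)
  show ?case
  proof (rule Ck_on_SucI[OF assms(1)])
    fix p assume p: "p \<in> S"
    show "((\<lambda>p. f p * g p) has_derivative
      (\<lambda>h. (D1 f p * g p + f p * D1 g p) * fst h + (D2 f p * g p + f p * D2 g p) * snd h)) (at p)"
      by (rule has_derivative_eq_rhs[OF has_derivative_mult[OF
            Suc.prems[THEN Ck_on_Suc_has_derivative[OF _ assms(1) p]]]])
        (simp add: algebra_simps)
  qed (use Suc Suc.prems[THEN Ck_on_Suc_imp] in \<open>auto intro!: Ck_on_add[OF assms(1)]\<close>)
qed

lemma Ck_on_minus: "open S \<Longrightarrow> Ck_on k S f \<Longrightarrow> Ck_on k S (\<lambda>p. - f p)"
  using Ck_on_mult[OF _ Ck_on_const[of k S "-1"], of f] by simp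

text \<open>The partials of \<open>1 / f\<close> are products of those of \<open>f\<close> with
  \<open>1 / f\<close> itself, so \<open>1 / f\<close> at level \<open>k\<close> yields level
  \<open>k + 1\<close>.\<close>

lemma Ck_on_inverse:
  assumes "open S" "\<And>p. p \<in> S \<Longrightarrow> f p \<noteq> 0" "Ck_on k S f"
  shows "Ck_on k S (\<lambda>p. inverse (f p))"
  using assms(3)
proof (induction k)
  case 0
  then show ?case using assms(2) by (auto intro!: continuous_on_inverse)
next
  case (Suc k)
  let ?g = "\<lambda>p. inverse (f p)"
  have k: "Ck_on k S ?g" using Suc Ck_on_Suc_imp by blast
  show ?case
  proof (rule Ck_on_SucI[OF assms(1)])
    fix p assume p: "p \<in> S"
    show "(?g has_derivative
      (\<lambda>h. - (D1 f p * (?g p * ?g p)) * fst h + - (D2 f p * (?g p * ?g p)) * snd h)) (at p)"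
      using Ck_on_Suc_has_derivative[OF Suc.prems assms(1) p] assms(2)[OF p]
      by (auto intro!: derivative_eq_intros simp: algebra_simps)
  qed (use Suc.prems k in \<open>auto intro!: Ck_on_mult[OF assms(1)] Ck_on_minus[OF assms(1)]\<close>)
qed

lemma smooth_on_const: "smooth_on S (\<lambda>p. c)"
  by (simp add: smooth_on_def Ck_on_const)

lemma smooth_on_add:
  "open S \<Longrightarrow> smooth_on S f \<Longrightarrow> smooth_on S g \<Longrightarrow> smooth_on S (\<lambda>p. f p + g p)"
  by (simp add: smooth_on_def Ck_on_add)

lemma smooth_on_mult:
  "open S \<Longrightarrow> smooth_on S f \<Longrightarrow> smooth_on S g \<Longrightarrow> smooth_on S (\<lambda>p. f p * g p)"
  by (simp add: smooth_on_def Ck_on_mult)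

lemma smooth_on_minus: "open S \<Longrightarrow> smooth_on S f \<Longrightarrow> smooth_on S (\<lambda>p. - f p)"
  by (simp add: smooth_on_def Ck_on_minus)

lemma smooth_on_diff:
  "open S \<Longrightarrow> smooth_on S f \<Longrightarrow> smooth_on S g \<Longrightarrow> smooth_on S (\<lambda>p. f p - g p)"
  using smooth_on_add[OF _ _ smooth_on_minus, of S f g] by simp

lemma smooth_on_power: "open S \<Longrightarrow> smooth_on S f \<Longrightarrow> smooth_on S (\<lambda>p. f p ^ k)"
  by (induction k) (simp_all add: smooth_on_const smooth_on_mult)

lemma smooth_on_divide:
  assumes "open S" "smooth_on S f" "smooth_on S g" "\<forall>p\<in>S. g p \<noteq> 0"
  shows "smooth_on S (\<lambda>p. f p / g p)"
proof -
  have "smooth_on S (\<lambda>p. inverse (g p))"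
    using assms by (simp add: smooth_on_def Ck_on_inverse)
  then show ?thesis
    using smooth_on_mult[OF assms(1,2)] by (simp add: divide_inverse)
qed

lemmas smooth_on_intros =
  smooth_on_const smooth_on_add smooth_on_mult smooth_on_minus smooth_on_diff smooth_on_power
  smooth_on_divide smooth_on_D

section \<open>Antiderivatives and potentials\<close>

text \<open>The integral of \<open>f\<close> in space from \<open>x0\<close> to \<open>x\<close>,
  rescaled to the fixed interval \<open>[0, 1]\<close>. This form suits the theorems on integrals
  with parameters, and the factor \<open>x - x0\<close> carries the sign when
  \<open>x < x0\<close>.\<close>

definition antideriv2 :: "real \<Rightarrow> field \<Rightarrow> field" where
  "antideriv2 x0 f = (\<lambda>(t, x). (x - x0) * integral (cbox 0 1) (\<lambda>s. f (t, x0 + s * (x - x0))))"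

lemma convex_affine_mem:
  fixes X :: "real set"
  assumes "convex X" "x0 \<in> X" "x \<in> X" "s \<in> cbox 0 1"
  shows "x0 + s * (x - x0) \<in> X"
  using convexD_alt[OF assms(1-3), of s] assms(4) by (simp add: algebra_simps)

lemma continuous_on_antideriv2:
  assumes "convex X" "x0 \<in> X" "continuous_on (T \<times> X) f"
  shows "continuous_on (T \<times> X) (antideriv2 x0 f)"
proof -
  have "continuous_on ((T \<times> X) \<times> cbox 0 1) (\<lambda>(p, s). f (fst p, x0 + s * (snd p - x0)))"
    unfolding split_beta using convex_affine_mem[OF assms(1,2)]
    by (intro continuous_on_compose2[OF assms(3)] continuous_intros) auto
  from integral_continuous_on_param[OF this] show ?thesis
    unfolding antideriv2_def split_beta by (intro continuous_intros)
qed

text \<open>The fundamental theorem of calculus: the slice has a classical primitive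
  \<open>g\<close>, and substitution turns the rescaled integral into
  \<open>g z - g x0\<close>.\<close>

lemma antideriv2_has_partial2:
  fixes x x0 :: real
  assumes X: "convex X" "open X" "x0 \<in> X" "x \<in> X" and t: "t \<in> T"
    and f: "continuous_on (T \<times> X) f"
  shows "((\<lambda>z. antideriv2 x0 f (t, z)) has_real_derivative f (t, x)) (at x)"
proof -
  \<comment> \<open>A compact interval in \<open>X\<close> with both \<open>x\<close> and the base
    point in its interior, so that one primitive serves for both.\<close>
  obtain a b where ab: "a < x" "a < x0" "x < b" "x0 < b" "{a..b} \<subseteq> X"
  proof -
    obtain e1 e2 where e: "e1 > 0" "cball x e1 \<subseteq> X" "e2 > 0" "cball x0 e2 \<subseteq> X"
      using X open_contains_cball by metis
    have "min (x - e1) (x0 - e2) \<in> X" "max (x + e1) (x0 + e2) \<in> X"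
      using e by (auto simp: min_def max_def dist_real_def subset_iff)
    then have "{min (x - e1) (x0 - e2)..max (x + e1) (x0 + e2)} \<subseteq> X"
      using X(1) by (meson atLeastAtMost_iff convex_contains_segment closed_segment_eq_real_ivl1
          is_interval_1 is_interval_convex_1 subsetI)
    with e show ?thesis by (intro that) (auto simp: min_def max_def)
  qed
  have "continuous_on {a..b} (\<lambda>z. f (t, z))"
    using t ab by (intro continuous_on_compose2[OF f] continuous_intros) auto
  then obtain g where g: "\<And>z. z \<in> {a..b} \<Longrightarrow> (g has_real_derivative f (t, z)) (at z within {a..b})"
    using antiderivative_continuous[of a b "\<lambda>z. f (t, z)"]
    by (metis has_real_derivative_iff_has_vector_derivative)
  have eq: "antideriv2 x0 f (t, z) = g z - g x0" if z: "z \<in> {a..b}" for z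
  proof -
    let ?l = "\<lambda>s. x0 + s * (z - x0)"
    have l: "?l s \<in> {a..b}" if "s \<in> {0..1}" for s
      using convex_affine_mem[of "{a..b}" x0 z s] ab z that by auto
    have "((g \<circ> ?l) has_real_derivative f (t, ?l s) * (z - x0)) (at s within {0..1})"
      if s: "s \<in> {0..1}" for s
    proof (rule DERIV_image_chain)
      show "(g has_real_derivative f (t, ?l s)) (at (?l s) within ?l ` {0..1})"
        using l by (intro DERIV_subset[OF g[OF l[OF s]]]) auto
    qed (auto intro!: derivative_eq_intros)
    then have "((\<lambda>s. f (t, ?l s) * (z - x0)) has_integral (g \<circ> ?l) 1 - (g \<circ> ?l) 0) {0..1}"
      by (intro fundamental_theorem_of_calculus)
        (simp_all add: has_real_derivative_iff_has_vector_derivative del: o_apply)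
    from integral_unique[OF this] show ?thesis
      by (simp add: antideriv2_def mult.commute[of "z - x0" "integral _ _"])
  qed
  have "((\<lambda>z. g z - g x0) has_real_derivative f (t, x)) (at x)"
    using g[of x] ab at_within_Icc_at[of a x b] by (auto intro!: derivative_eq_intros)
  then show ?thesis
    using eq ab
    by (subst DERIV_cong_ev[OF refl _ refl, where g = "\<lambda>z. g z - g x0"])
      (auto intro: eventually_nhds_in_open[of "{a<..<b}", THEN eventually_mono])
qed

text \<open>Differentiation under the integral sign, over the fixed interval.\<close>

lemma antideriv2_has_partial1:
  fixes x x0 :: real
  assumes X: "convex X" "x0 \<in> X" "x \<in> X" and T: "convex T" "open T" "t \<in> T"
    and f: "continuous_on (T \<times> X) f" "continuous_on (T \<times> X) f1"
    and der: "\<And>s z. s \<in> T \<Longrightarrow> z \<in> X \<Longrightarrow> ((\<lambda>r. f (r, z)) has_real_derivative f1 (s, z)) (at s)"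
  shows "((\<lambda>s. antideriv2 x0 f (s, x)) has_real_derivative antideriv2 x0 f1 (t, x)) (at t)"
proof -
  note l = convex_affine_mem[OF X]
  have "((\<lambda>r. integral (cbox 0 1) (\<lambda>s. f (r, x0 + s * (x - x0)))) has_real_derivative
      integral (cbox 0 1) (\<lambda>s. f1 (t, x0 + s * (x - x0)))) (at t within T)"
  proof (rule leibniz_rule_field_derivative[where fx = "\<lambda>r s. f1 (r, x0 + s * (x - x0))"])
    show "(\<lambda>s. f (r, x0 + s * (x - x0))) integrable_on cbox 0 1" if "r \<in> T" for r
      using l that by (intro integrable_continuous continuous_on_compose2[OF f(1)] continuous_intros) auto
    show "continuous_on (T \<times> cbox 0 1) (\<lambda>(r, s). f1 (r, x0 + s * (x - x0)))"
      using l unfolding split_beta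
      by (intro continuous_on_compose2[OF f(2)] continuous_intros) auto
  qed (use T l in \<open>auto intro: has_field_derivative_at_within der\<close>)
  then show ?thesis
    by (simp add: antideriv2_def at_within_open[OF T(3,2)] DERIV_cmult)
qed

text \<open>Total differentiability follows when one partial is continuous on the rectangle, here
  the space one, and the other exists at the point \<open>(t, x)\<close>.\<close>

lemma has_derivative_of_partials:
  assumes "open T" "open X" "convex X" "(t, x) \<in> T \<times> X"
    and "((\<lambda>s. f (s, x)) has_real_derivative d) (at t)"
    and "\<And>s z. (s, z) \<in> T \<times> X \<Longrightarrow> ((\<lambda>z. f (s, z)) has_real_derivative f2 (s, z)) (at z)"
    and "continuous_on (T \<times> X) f2"
  shows "(f has_derivative (\<lambda>h. d * fst h + f2 (t, x) * snd h)) (at (t, x))"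
proof -
  have "((\<lambda>(s, z). f (s, z)) has_derivative
     (\<lambda>(ts, tz). d * ts + blinfun_mult_right (f2 (t, x)) tz)) (at (t, x) within T \<times> X)"
  proof (rule has_derivative_partialsI[where fy = "\<lambda>s z. blinfun_mult_right (f2 (s, z))"])
    show "((\<lambda>s. f (s, x)) has_derivative (*) d) (at t within T)"
      using assms(5) by (simp add: has_field_derivative_def has_derivative_at_withinI)
    show "((\<lambda>z. f (s, z)) has_derivative blinfun_mult_right (f2 (s, z))) (at z within X)"
      if "s \<in> T" "z \<in> X" for s z
      using assms(6)[of s z] that
      by (simp add: has_field_derivative_def has_derivative_at_withinI blinfun_mult_right.rep_eq)
    have "continuous (at (t, x) within T \<times> X) f2"
      using assms(4,7) by (simp add: continuous_on_eq_continuous_within)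
    then show "continuous (at (t, x) within T \<times> X) (\<lambda>(s, z). blinfun_mult_right (f2 (s, z)))"
      unfolding split_beta prod.collapse
      by (rule bounded_linear.continuous[OF bounded_linear_blinfun_mult_right])
  qed (use assms in auto)
  then show ?thesis
    by (simp add: at_within_open[OF assms(4) open_Times[OF assms(1,2)]] split_beta'
        blinfun_mult_right.rep_eq)
qed

text \<open>Differentiating in time gives the antiderivative of \<open>D1 f\<close>, covered by the
  induction hypothesis; differentiating in space gives back \<open>f\<close>. Both partials are thus
  \<open>C^k\<close>.\<close>

lemma Ck_on_antideriv2:
  assumes TX: "open T" "convex T" "open X" "convex X" "x0 \<in> X" and "Ck_on k (T \<times> X) f"
  shows "Ck_on k (T \<times> X) (antideriv2 x0 f)"
  using assms(6)
proof (induction k arbitrary: f)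
  case 0
  then show ?case using TX by (simp add: continuous_on_antideriv2)
next
  case (Suc k)
  have o: "open (T \<times> X)" using TX by (simp add: open_Times)
  have k: "Ck_on k (T \<times> X) f" "Ck_on k (T \<times> X) (D1 f)"
    using Ck_on_Suc_imp[OF Suc.prems] Suc.prems by simp_all
  have cont: "continuous_on (T \<times> X) g" if "Ck_on k (T \<times> X) g" for g
    using that by (cases k) (auto simp: differentiable_imp_continuous_on)
  show ?case
  proof (rule Ck_on_SucI[OF o])
    fix p assume p: "p \<in> T \<times> X"
    obtain t x where [simp]: "p = (t, x)" by (cases p)
    have "((\<lambda>s. antideriv2 x0 f (s, x)) has_real_derivative antideriv2 x0 (D1 f) (t, x)) (at t)"
    proof (rule antideriv2_has_partial1)
      fix s z assume "s \<in> T" "z \<in> X"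
      then show "((\<lambda>r. f (r, z)) has_real_derivative D1 f (s, z)) (at s)"
        using partial_has_real_derivative(1)[OF Ck_on_Suc_has_derivative[OF Suc.prems o, of "(s, z)"]]
        by simp
    qed (use p TX k cont in auto)
    then show "(antideriv2 x0 f has_derivative
        (\<lambda>h. antideriv2 x0 (D1 f) p * fst h + f p * snd h)) (at p)"
      unfolding \<open>p = (t, x)\<close> using p TX cont k
      by (intro has_derivative_of_partials antideriv2_has_partial2) auto
  qed (use k Suc.IH in auto)
qed

text \<open>Write \<open>f (s, z)\<close> as \<open>f (s, x)\<close> plus the integral of
  \<open>D2 f\<close> from \<open>x\<close> to \<open>z\<close>, differentiate in \<open>s\<close>
  under the integral, then in \<open>z\<close>.\<close>

lemma D1_D2_commute:
  assumes TX: "open T" "convex T" "open X" "convex X" and f: "smooth_on (T \<times> X) f"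
    and p: "(t, x) \<in> T \<times> X"
  shows "D1 (D2 f) (t, x) = D2 (D1 f) (t, x)"
proof -
  have o: "open (T \<times> X)" using TX by (simp add: open_Times)
  note f_has = smooth_on_has_partials[OF _ o]
  have x: "x \<in> X" "t \<in> T" using p by auto
  have eq: "f (s, z) = f (s, x) + antideriv2 x (D2 f) (s, z)" if "s \<in> T" "z \<in> X" for s z
  proof -
    have "\<exists>c. \<forall>z\<in>X. f (s, z) - antideriv2 x (D2 f) (s, z) = c"
    proof (rule has_field_derivative_zero_constant[OF TX(4)])
      fix z assume z: "z \<in> X"
      have "((\<lambda>z. f (s, z) - antideriv2 x (D2 f) (s, z)) has_real_derivative
          D2 f (s, z) - D2 f (s, z)) (at z)"
        using that x z TX f
        by (intro DERIV_diff f_has antideriv2_has_partial2 smooth_on_continuous smooth_on_D) auto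
      then show "((\<lambda>z. f (s, z) - antideriv2 x (D2 f) (s, z)) has_real_derivative 0) (at z within X)"
        by (simp add: has_field_derivative_at_within)
    qed
    then have "f (s, z) - antideriv2 x (D2 f) (s, z) = f (s, x) - antideriv2 x (D2 f) (s, x)"
      using that x by metis
    then show ?thesis by (simp add: antideriv2_def)
  qed
  have "D1 f (t, z) = D1 f (t, x) + antideriv2 x (D1 (D2 f)) (t, z)" if "z \<in> X" for z
  proof -
    have "((\<lambda>s. f (s, x) + antideriv2 x (D2 f) (s, z)) has_real_derivative
        D1 f (t, x) + antideriv2 x (D1 (D2 f)) (t, z)) (at t)"
      using that x TX f
      by (intro DERIV_add f_has antideriv2_has_partial1[where T = T and X = X]
          smooth_on_continuous smooth_on_D) auto
    moreover have "\<forall>\<^sub>F s in nhds t. f (s, z) = f (s, x) + antideriv2 x (D2 f) (s, z)"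
      using eventually_nhds_in_open[OF TX(1) x(2)] by eventually_elim (use eq that in auto)
    ultimately show ?thesis
      by (intro D1_eqI) (subst DERIV_cong_ev[OF refl _ refl], auto)
  qed
  moreover have "((\<lambda>z. D1 f (t, x) + antideriv2 x (D1 (D2 f)) (t, z)) has_real_derivative D1 (D2 f) (t, x)) (at x)"
    using x TX f by (auto intro!: derivative_eq_intros antideriv2_has_partial2 smooth_on_continuous smooth_on_D)
  moreover have "\<forall>\<^sub>F z in nhds x. z \<in> X" using TX x by (simp add: eventually_nhds_in_open)
  ultimately have "((\<lambda>z. D1 f (t, z)) has_real_derivative D1 (D2 f) (t, x)) (at x)"
    by (subst DERIV_cong_ev[OF refl _ refl, where g = "\<lambda>z. D1 f (t, x) + antideriv2 x (D1 (D2 f)) (t, z)"])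
      (auto elim: eventually_mono)
  then show ?thesis by (simp add: D2_eqI)
qed

lemma smooth_antiderivative:
  assumes "open T" "convex T" "open X" "convex X" "smooth_on (T \<times> X) f"
  obtains F where "smooth_on (T \<times> X) F" "\<And>p. p \<in> T \<times> X \<Longrightarrow> D2 F p = f p"
proof (cases "X = {}")
  case True
  with that[of f] assms(5) show thesis by simp
next
  case False
  then obtain x0 where "x0 \<in> X" by blast
  moreover from this have "D2 (antideriv2 x0 f) p = f p" if "p \<in> T \<times> X" for p
    using that assms antideriv2_has_partial2[of X x0 _ _ T f]
    by (cases p) (auto intro!: D2_eqI smooth_on_continuous)
  ultimately show thesis
    using assms by (intro that[of "antideriv2 x0 f"]) (auto simp: smooth_on_def Ck_on_antideriv2)
qed

text \<open>The Poincare lemma on a rectangle. An antiderivative \<open>y0\<close> of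
  \<open>f\<close> in space misses the prescribed time derivative by a term that is constant in
  space, because mixed partials agree. Subtracting a primitive of that term in time corrects
  this.\<close>

lemma smooth_potential:
  assumes TX: "open T" "convex T" "open X" "convex X"
    and f: "smooth_on (T \<times> X) f" and g: "smooth_on (T \<times> X) g"
    and fg: "\<And>p. p \<in> T \<times> X \<Longrightarrow> D1 f p = D2 g p"
  obtains y where "smooth_on (T \<times> X) y" "\<And>p. p \<in> T \<times> X \<Longrightarrow> D1 y p = g p"
    "\<And>p. p \<in> T \<times> X \<Longrightarrow> D2 y p = f p"
proof (cases "T \<times> X = {}")
  case True
  with that[of f] f show thesis by simp
next
  case False
  then obtain t0 x0 where x0: "t0 \<in> T" "x0 \<in> X" by blast
  have o: "open (T \<times> X)" using TX by (simp add: open_Times)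
  note has = smooth_on_has_partials[OF _ o]
  obtain y0 where y0: "smooth_on (T \<times> X) y0" "\<And>p. p \<in> T \<times> X \<Longrightarrow> D2 y0 p = f p"
    using smooth_antiderivative[OF TX f] by blast
  define h where "h t = D1 y0 (t, x0) - g (t, x0)" for t
  have h: "D1 y0 (t, x) - g (t, x) = h t" if "t \<in> T" "x \<in> X" for t x
  proof -
    have "\<exists>c. \<forall>x\<in>X. D1 y0 (t, x) - g (t, x) = c"
    proof (rule has_field_derivative_zero_constant[OF TX(4)])
      fix z assume "z \<in> X"
      then have z: "(t, z) \<in> T \<times> X" using that by simp
      have "D2 (D1 y0) (t, z) = D1 (D2 y0) (t, z)" using D1_D2_commute[OF TX y0(1) z] by simp
      also have "\<dots> = D1 f (t, z)" using D_cong(1)[OF o z y0(2)] by simp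
      finally have "D2 (D1 y0) (t, z) = D2 g (t, z)" using fg[OF z] by simp
      with DERIV_diff[OF has(2)[OF smooth_on_D(1)[OF y0(1)] z] has(2)[OF g z]]
      show "((\<lambda>x. D1 y0 (t, x) - g (t, x)) has_real_derivative 0) (at z within X)"
        by (simp add: has_field_derivative_at_within)
    qed
    with that x0 show ?thesis unfolding h_def by metis
  qed
  \<comment> \<open>\<open>antideriv2\<close> integrates in its second argument, so time is put
    there, with the dummy value \<open>0\<close> in the first.\<close>
  define H where "H t = antideriv2 t0 (\<lambda>p. h (snd p)) (0, t)" for t
  have "continuous_on (T \<times> X) (\<lambda>p. D1 y0 p - g p)"
    using smooth_on_diff[OF o smooth_on_D(1)[OF y0(1)] g]
    by (metis smooth_on_def Ck_on.simps(1))
  then have "continuous_on ({0} \<times> T) (\<lambda>p. D1 y0 (snd p, x0) - g (snd p, x0))"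
    by (rule continuous_on_compose2) (use x0 in \<open>auto intro!: continuous_intros\<close>)
  then have H: "(H has_real_derivative h t) (at t)" if "t \<in> T" for t
    using antideriv2_has_partial2[OF TX(2,1) x0(1) that, of 0 "{0}" "\<lambda>p. h (snd p)"]
    by (simp add: h_def H_def[abs_def])
  define y where "y = (\<lambda>p. y0 p - H (fst p))"
  have y: "(y has_derivative (\<lambda>k. g p * fst k + f p * snd k)) (at p)" if p: "p \<in> T \<times> X" for p
  proof -
    have "((\<lambda>p. H (fst p)) has_derivative (\<lambda>k. h (fst p) * fst k)) (at p)"
      by (rule has_derivative_compose[of fst fst p UNIV H "\<lambda>k. h (fst p) * k"])
        (use H[of "fst p"] p in \<open>auto simp: has_field_derivative_def intro!: derivative_intros\<close>)
    from has_derivative_diff[OF smooth_on_has_derivative[OF y0(1) o p] this]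
    show ?thesis
      unfolding y_def
      by (rule has_derivative_eq_rhs) (use h[of "fst p" "snd p"] y0(2)[OF p] p in \<open>auto simp: algebra_simps\<close>)
  qed
  have "smooth_on (T \<times> X) y"
    unfolding smooth_on_def
  proof
    fix k show "Ck_on k (T \<times> X) y"
    \<comment> \<open>The partials of \<open>y\<close> are \<open>g\<close> and \<open>f\<close>,
      both \<open>C^k\<close>, so \<open>y\<close> is even \<open>C^(k+1)\<close>.\<close>
    proof (rule Ck_on_Suc_imp, rule Ck_on_SucI[OF o y])
      show "Ck_on k (T \<times> X) g" "Ck_on k (T \<times> X) f" using f g by (auto simp: smooth_on_def)
    qed
  qed
  with partials_eqI[OF y] that[of y] show thesis by simp
qed

section \<open>The operators of the two hierarchies\<close>

lemma eq_on_sym: "eq_on S v w \<Longrightarrow> eq_on S w v"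
  and eq_on_trans: "eq_on S u v \<Longrightarrow> eq_on S v w \<Longrightarrow> eq_on S u w"
  by (auto simp: eq_on_def)

lemma eq_onD: "eq_on S v w \<Longrightarrow> p \<in> S \<Longrightarrow> fst v p = fst w p" "eq_on S v w \<Longrightarrow> p \<in> S \<Longrightarrow> snd v p = snd w p"
  by (auto simp: eq_on_def)

lemma Rbar_cong:
  assumes "open S" "(v, w) \<in> Rbar S Q P" "eq_on S v v'" "eq_on S w w'"
  shows "(v', w') \<in> Rbar S Q P"
proof -
  obtain a b a' b' where v: "v = (a, b)" "v' = (a', b')" by fastforce
  have eq: "a p = a' p" "b p = b' p" if "p \<in> S" for p
    using assms(3) that by (auto simp: eq_on_def v)
  have "D2 (D2 b) p = D2 (D2 b') p" if "p \<in> S" for p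
    by (rule D_cong(2)[OF assms(1) that D_cong(2)[OF assms(1) _ eq(2)]])
  with eq assms(2,4) show ?thesis
    unfolding v Rbar_def eq_on_def by auto
qed

text \<open>The endpoint may have to change: the zeroth power is literal equality, so there
  \<open>w'\<close> is \<open>v'\<close>. In a positive power the first step already forgets values
  outside \<open>S\<close>, and \<open>w\<close> can stay.\<close>

lemma Rbar_relpow_cong:
  assumes "open S" "(v, w) \<in> Rbar S Q P ^^ k" "eq_on S v v'"
  obtains w' where "(v', w') \<in> Rbar S Q P ^^ k" "eq_on S w w'"
proof (cases k)
  case 0
  with assms that show thesis by auto
next
  case (Suc j)
  with assms obtain u where "(v, u) \<in> Rbar S Q P" "(u, w) \<in> Rbar S Q P ^^ j"
    by (meson relpow_Suc_E2)
  with Suc have "(v', w) \<in> Rbar S Q P ^^ k"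
    using Rbar_cong[OF assms(1) _ assms(3), of u Q P u] by (auto simp only: eq_on_def intro: relpow_Suc_I2)
  with that show thesis by (auto simp: eq_on_def)
qed

lemma JKinvE:
  assumes "(v, w) \<in> JKinv S m \<rho>"
  obtains a b where "smooth_on S a" "smooth_on S b" "eq_on S v (K_op m \<rho> (a, b))" "eq_on S w (J_op (a, b))"
  using assms unfolding JKinv_def op_graph_def by auto

lemma JKinvI:
  assumes "smooth_on S a" "smooth_on S b" "eq_on S v (K_op m \<rho> (a, b))" "eq_on S w (J_op (a, b))"
  shows "(v, w) \<in> JKinv S m \<rho>"
  unfolding JKinv_def op_graph_def
  by (rule relcompI[of _ "(a, b)"]) (use assms in \<open>auto simp del: K_op.simps J_op.simps\<close>)

text \<open>Read backwards, the chain that builds a positive flow is a chain of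
  \<open>JKinv\<close>, so both halves of the hierarchy are handled with one relation.\<close>

lemma KJinv_relpow: "KJinv S m \<rho> ^^ k = (JKinv S m \<rho> ^^ k)\<inverse>"
proof -
  have "KJinv S m \<rho> = (JKinv S m \<rho>)\<inverse>"
    unfolding KJinv_def JKinv_def by (simp add: converse_relcomp)
  moreover have "(R\<inverse>) ^^ k = (R ^^ k)\<inverse>" for R :: "'a rel"
  proof (induction k)
    case (Suc k)
    have "(R\<inverse>) ^^ Suc k = R\<inverse> O (R\<inverse>) ^^ k" by (simp add: relpow_commute)
    with Suc show ?case by (simp add: converse_relcomp)
  qed simp
  ultimately show ?thesis by simp
qed

lemma K_op_eq:
  assumes "open S" "p \<in> S" "smooth_on S m" "smooth_on S \<rho>" "smooth_on S a"
  shows "fst (K_op m \<rho> (a, b)) p = 2 * m p * D2 a p + D2 m p * a p + \<rho> p * D2 b p"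
    and "snd (K_op m \<rho> (a, b)) p = D2 \<rho> p * a p + \<rho> p * D2 a p"
proof -
  obtain t x where p: "p = (t, x)" by (cases p)
  note has = smooth_on_has_partials(2)[OF _ assms(1,2)[unfolded p]]
  have "D2 (\<lambda>q. m q * a q) p = D2 m p * a p + m p * D2 a p"
    "D2 (\<lambda>q. \<rho> q * a q) p = D2 \<rho> p * a p + \<rho> p * D2 a p"
    unfolding p by (rule D2_eqI, auto intro!: derivative_eq_intros has assms simp: mult.commute)+
  then show "fst (K_op m \<rho> (a, b)) p = 2 * m p * D2 a p + D2 m p * a p + \<rho> p * D2 b p"
    "snd (K_op m \<rho> (a, b)) p = D2 \<rho> p * a p + \<rho> p * D2 a p"
    by (simp_all add: algebra_simps)
qed

text \<open>\<open>K_op\<close> is triangular: integrating its second row gives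
  \<open>\<rho> a\<close>, and the first row then prescribes \<open>D2 b\<close>, which is
  integrated in turn.\<close>

lemma K_op_surj:
  assumes TX: "open T" "convex T" "open X" "convex X"
    and sm: "smooth_on (T \<times> X) m" "smooth_on (T \<times> X) \<rho>" "\<forall>p\<in>T \<times> X. \<rho> p \<noteq> 0"
    and v: "smooth_on (T \<times> X) (fst v)" "smooth_on (T \<times> X) (snd v)"
  obtains a b where "smooth_on (T \<times> X) a" "smooth_on (T \<times> X) b" "eq_on (T \<times> X) v (K_op m \<rho> (a, b))"
proof -
  have o: "open (T \<times> X)" using TX by (simp add: open_Times)
  obtain A where A: "smooth_on (T \<times> X) A" "\<And>p. p \<in> T \<times> X \<Longrightarrow> D2 A p = snd v p"
    using smooth_antiderivative[OF TX v(2)] by blast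
  define a where "a = (\<lambda>p. A p / \<rho> p)"
  have a: "smooth_on (T \<times> X) a"
    unfolding a_def by (intro smooth_on_divide o A sm)
  have "smooth_on (T \<times> X) (\<lambda>p. (fst v p - (m p * D2 a p + D2 (\<lambda>q. m q * a q) p)) / \<rho> p)"
    by (intro smooth_on_intros o sm v a)
  then obtain b where b: "smooth_on (T \<times> X) b"
    "\<And>p. p \<in> T \<times> X \<Longrightarrow> D2 b p = (fst v p - (m p * D2 a p + D2 (\<lambda>q. m q * a q) p)) / \<rho> p"
    using smooth_antiderivative[OF TX] by blast
  have "D2 (\<lambda>q. \<rho> q * a q) p = snd v p" if "p \<in> T \<times> X" for p
    using D_cong(2)[OF o that, of "\<lambda>q. \<rho> q * a q" A] A(2)[OF that] sm(3) by (simp add: a_def)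
  with b(2) sm(3) have "eq_on (T \<times> X) v (K_op m \<rho> (a, b))"
    by (simp add: eq_on_def)
  with a b(1) that show thesis by blast
qed

section \<open>Derivatives of the transformed fields and covariance of the Schwarzian\<close>

lemma D2_inverse:
  assumes "open S" "p \<in> S" "smooth_on S \<rho>" "\<rho> p \<noteq> 0"
  shows "D2 (\<lambda>p. 1 / \<rho> p) p = - D2 \<rho> p / (\<rho> p)\<^sup>2"
proof -
  obtain t x where p: "p = (t, x)" by (cases p)
  show ?thesis
    using assms(4) smooth_on_has_partials(2)[OF assms(3,1) assms(2)[unfolded p]] unfolding p
    by (intro D2_eqI) (auto intro!: derivative_eq_intros simp: power2_eq_square)
qed

text \<open>With \<open>y_x = \<rho>\<close> this is \<open>- (1/4 + s/2) / \<rho>^2\<close>, where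
  \<open>s\<close> is the Schwarzian derivative of \<open>y\<close> in \<open>x\<close>.\<close>

definition liouville_Q :: "field \<Rightarrow> field" where
  "liouville_Q \<rho> = (\<lambda>p. - (1/4) / (\<rho> p)^2 + 3/4 * (D2 \<rho> p)^2 / (\<rho> p)^4 - 1/2 * D2 (D2 \<rho>) p / (\<rho> p)^3)"

lemma liouville_Q_partials:
  assumes S: "open S" "p \<in> S" and \<rho>: "smooth_on S \<rho>" "\<rho> p \<noteq> 0"
  shows "D1 (liouville_Q \<rho>) p = D1 \<rho> p / (2 * \<rho> p ^ 3) + 3/2 * D2 \<rho> p * D1 (D2 \<rho>) p / \<rho> p ^ 4
      - 3 * (D2 \<rho> p)^2 * D1 \<rho> p / \<rho> p ^ 5 - D1 (D2 (D2 \<rho>)) p / (2 * \<rho> p ^ 3)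
      + 3/2 * D2 (D2 \<rho>) p * D1 \<rho> p / \<rho> p ^ 4" (is ?D1)
    and "D2 (liouville_Q \<rho>) p = D2 \<rho> p / (2 * \<rho> p ^ 3) + 3/2 * D2 \<rho> p * D2 (D2 \<rho>) p / \<rho> p ^ 4
      - 3 * (D2 \<rho> p)^2 * D2 \<rho> p / \<rho> p ^ 5 - D2 (D2 (D2 \<rho>)) p / (2 * \<rho> p ^ 3)
      + 3/2 * D2 (D2 \<rho>) p * D2 \<rho> p / \<rho> p ^ 4" (is ?D2)
proof -
  \<comment> \<open>A one-variable computation with \<open>r\<close>, \<open>r1\<close>,
    \<open>r2\<close> treated as unrelated functions, so that it applies to time slices and space
    slices alike.\<close>
  have der: "((\<lambda>z. - (1/4) / (r z)^2 + 3/4 * (r1 z)^2 / (r z)^4 - 1/2 * r2 z / (r z)^3) has_real_derivative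
      d / (2 * r x ^ 3) + 3/2 * r1 x * d1 / r x ^ 4 - 3 * (r1 x)^2 * d / r x ^ 5
      - d2 / (2 * r x ^ 3) + 3/2 * r2 x * d / r x ^ 4) (at x)"
    if "(r has_real_derivative d) (at x)" "(r1 has_real_derivative d1) (at x)"
      "(r2 has_real_derivative d2) (at x)" "r x \<noteq> 0" for r r1 r2 :: "real \<Rightarrow> real" and d d1 d2 x
    using that
    by (auto intro!: derivative_eq_intros) (simp add: field_simps power2_eq_square eval_nat_numeral)
  obtain t x where p: "p = (t, x)" by (cases p)
  note has = smooth_on_has_partials[OF _ S[unfolded p]]
  show ?D1 ?D2
    using \<rho> unfolding p liouville_Q_def
    by (intro D1_eqI D2_eqI, simp only: prod.case, intro der has smooth_on_D; simp)+
qed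

definition liouville_P :: "field \<Rightarrow> field \<Rightarrow> field" where
  "liouville_P m \<rho> = (\<lambda>p. - m p / (\<rho> p)\<^sup>2)"

lemma liouville_P_partials:
  assumes S: "open S" "p \<in> S" and sm: "smooth_on S m" "smooth_on S \<rho>" "\<rho> p \<noteq> 0"
  shows "D1 (liouville_P m \<rho>) p = - D1 m p / (\<rho> p)\<^sup>2 + 2 * m p * D1 \<rho> p / (\<rho> p)^3" (is ?D1)
    and "D2 (liouville_P m \<rho>) p = - D2 m p / (\<rho> p)\<^sup>2 + 2 * m p * D2 \<rho> p / (\<rho> p)^3" (is ?D2)
proof -
  have der: "((\<lambda>z. - f z / (r z)^2) has_real_derivative - d1 / (r x)\<^sup>2 + 2 * f x * d / (r x)^3) (at x)"
    if "(f has_real_derivative d1) (at x)" "(r has_real_derivative d) (at x)" "r x \<noteq> 0"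
    for f r :: "real \<Rightarrow> real" and d d1 x
    using that
    by (auto intro!: derivative_eq_intros) (simp add: field_simps power2_eq_square eval_nat_numeral)
  obtain t x where p: "p = (t, x)" by (cases p)
  note has = smooth_on_has_partials[OF _ S[unfolded p]]
  show ?D1 ?D2
    using sm unfolding p liouville_P_def
    by (intro D1_eqI D2_eqI, intro der has; simp)+
qed

text \<open>For the flow of index 0, whose right-hand side vanishes, this supplies a nonzero
  preimage under \<open>K_op\<close>.\<close>

lemma K_op_kernel:
  assumes S: "open S" and sm: "smooth_on S m" "smooth_on S \<rho>" "\<forall>p\<in>S. \<rho> p \<noteq> 0"
  shows "eq_on S (K_op m \<rho> (\<lambda>p. 1 / \<rho> p, liouville_P m \<rho>)) (\<lambda>p. 0, \<lambda>p. 0)"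
proof -
  have a: "smooth_on S (\<lambda>p. 1 / \<rho> p)" by (intro smooth_on_intros S sm)
  have "fst (K_op m \<rho> (\<lambda>p. 1 / \<rho> p, liouville_P m \<rho>)) p = 0 \<and>
      snd (K_op m \<rho> (\<lambda>p. 1 / \<rho> p, liouville_P m \<rho>)) p = 0" if p: "p \<in> S" for p
  proof -
    have nz: "\<rho> p \<noteq> 0" using sm p by blast
    show ?thesis
      using nz
      unfolding K_op_eq[OF S p sm(1,2) a] D2_inverse[OF S p sm(2) nz]
        liouville_P_partials(2)[OF S p sm(1,2) nz]
      by (simp add: field_simps power2_eq_square eval_nat_numeral)
  qed
  then show ?thesis by (simp add: eq_on_def del: K_op.simps)
qed

text \<open>With \<open>\<beta> = - \<rho> a\<close> and \<open>\<partial>\<^sub>y = \<rho>\<^sup>-\<^sup>1 \<partial>\<^sub>x\<close>, this says that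
  \<open>1/2 (\<partial>\<^sub>y\<^sup>3 + 4 Q \<partial>\<^sub>y + 2 Q\<^sub>y) \<beta> = (a\<^sub>x - a\<^sub>x\<^sub>x\<^sub>x) / (2 \<rho>\<^sup>2)\<close>.\<close>

lemma schwarzian_covariance:
  assumes S: "open S" "p \<in> S" and \<rho>: "smooth_on S \<rho>" "\<forall>p\<in>S. \<rho> p \<noteq> 0" and a: "smooth_on S a"
    and B: "\<And>q. q \<in> S \<Longrightarrow> B q = - (D2 \<rho> q * a q + \<rho> q * D2 a q) / \<rho> q"
  shows "1/2 * (D2 (\<lambda>q. D2 B q / \<rho> q) p / \<rho> p + 4 * liouville_Q \<rho> p * B p
      - 2 * D2 (liouville_Q \<rho>) p * a p) = (D2 a p - D2 (D2 (D2 a)) p) / (2 * (\<rho> p)^2)"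
proof -
  \<comment> \<open>The derivative of \<open>B\<close> is computed on all of \<open>S\<close>, not
    just at \<open>p\<close>, since it is differentiated again.\<close>
  have B1: "D2 B q = - ((D2 (D2 \<rho>) q * a q + D2 \<rho> q * D2 a q) / \<rho> q
      - (D2 \<rho> q)^2 * a q / (\<rho> q)^2 + D2 (D2 a) q)" if q: "q \<in> S" for q
  proof -
    obtain t x where tx: "q = (t, x)" by (cases q)
    note has = smooth_on_has_partials(2)[OF _ S(1) q[unfolded tx]]
    have nz: "\<rho> (t, x) \<noteq> 0" using \<rho>(2) q tx by auto
    have "D2 B q = D2 (\<lambda>q. - (D2 \<rho> q * a q + \<rho> q * D2 a q) / \<rho> q) q"
      by (rule D_cong(2)[OF S(1) q B])
    also have "\<dots> = - ((D2 (D2 \<rho>) q * a q + D2 \<rho> q * D2 a q) / \<rho> q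
      - (D2 \<rho> q)^2 * a q / (\<rho> q)^2 + D2 (D2 a) q)"
      unfolding tx
      by (rule D2_eqI, auto intro!: derivative_eq_intros has smooth_on_D \<rho> a nz)
        (use nz in \<open>simp_all add: field_simps power2_eq_square\<close>)
    finally show ?thesis .
  qed
  obtain t x where tx: "p = (t, x)" by (cases p)
  note has = smooth_on_has_partials(2)[OF _ S[unfolded tx]]
  have nz: "\<rho> (t, x) \<noteq> 0" using \<rho>(2) S(2) tx by auto
  have "D2 (\<lambda>q. D2 B q / \<rho> q) p = D2 (\<lambda>q. - ((D2 (D2 \<rho>) q * a q + D2 \<rho> q * D2 a q) / \<rho> q
      - (D2 \<rho> q)^2 * a q / (\<rho> q)^2 + D2 (D2 a) q) / \<rho> q) p"
    by (rule D_cong(2)[OF S]) (simp add: B1)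
  also have "\<dots> = - (D2 (D2 (D2 \<rho>)) p * a p + 2 * D2 (D2 \<rho>) p * D2 a p + D2 \<rho> p * D2 (D2 a) p) / (\<rho> p)^2
      + 2 * (D2 (D2 \<rho>) p * a p + D2 \<rho> p * D2 a p) * D2 \<rho> p / (\<rho> p)^3
      + (2 * D2 \<rho> p * D2 (D2 \<rho>) p * a p + (D2 \<rho> p)^2 * D2 a p) / (\<rho> p)^3
      - 3 * (D2 \<rho> p)^3 * a p / (\<rho> p)^4
      - D2 (D2 (D2 a)) p / \<rho> p + D2 (D2 a) p * D2 \<rho> p / (\<rho> p)^2"
    unfolding tx
    by (rule D2_eqI, auto intro!: derivative_eq_intros has smooth_on_D \<rho> a nz)
      (use nz in \<open>simp_all add: field_simps power2_eq_square eval_nat_numeral\<close>)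
  finally have E1: "D2 (\<lambda>q. D2 B q / \<rho> q) p = \<dots>" .
  have Q: "liouville_Q \<rho> p = - (1/4) / (\<rho> p)^2 + 3/4 * (D2 \<rho> p)^2 / (\<rho> p)^4 - 1/2 * D2 (D2 \<rho>) p / (\<rho> p)^3"
    by (simp add: liouville_Q_def)
  have "\<rho> p \<noteq> 0" using \<rho>(2) S(2) by auto
  then show ?thesis
    unfolding E1 B[OF S(2)] liouville_Q_partials(2)[OF S \<rho>(1) \<open>\<rho> p \<noteq> 0\<close>] Q
    by (simp add: field_simps power2_eq_square eval_nat_numeral)
qed

section \<open>The Liouville transformation\<close>

locale liouville =
  fixes T X :: "real set" and m \<rho> y :: field
  assumes TX: "open T" "convex T" "open X" "convex X"
    and m: "smooth_on (T \<times> X) m" and \<rho>: "smooth_on (T \<times> X) \<rho>" "\<forall>p\<in>T \<times> X. \<rho> p \<noteq> 0"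
    and y: "smooth_on (T \<times> X) y" "\<And>p. p \<in> T \<times> X \<Longrightarrow> D2 y p = \<rho> p"
begin

abbreviation S where "S \<equiv> T \<times> X"
abbreviation \<Phi> where "\<Phi> \<equiv> liouville_map y"
definition \<Psi> where "\<Psi> = inv_into S \<Phi>"
definition Q where "Q = (\<lambda>q. liouville_Q \<rho> (\<Psi> q))"
definition P where "P = (\<lambda>q. liouville_P m \<rho> (\<Psi> q))"
text \<open>The matrix \<open>M\<close> of the opening comment, followed by the passage to the
  variables \<open>(\<tau>, y)\<close>.\<close>

definition push :: "vfield \<Rightarrow> vfield" where
  "push v = (\<lambda>q. fst v (\<Psi> q) / (2 * (\<rho> (\<Psi> q))\<^sup>2), \<lambda>q. - snd v (\<Psi> q) / \<rho> (\<Psi> q))"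

lemma open_S: "open S"
  using TX by (simp add: open_Times)

lemma \<rho>_nz: "p \<in> S \<Longrightarrow> \<rho> p \<noteq> 0"
  using \<rho> by blast

text \<open>Time is preserved, so points with the same image lie on one slice; there the mean value
  theorem and \<open>\<rho> \<noteq> 0\<close> force them to coincide.\<close>

lemma inj_liouville_map: "inj_on \<Phi> S"
proof (rule inj_onI)
  fix p q assume pq: "p \<in> S" "q \<in> S" "\<Phi> p = \<Phi> q"
  obtain t x z where p: "p = (t, x)" "q = (t, z)"
    using pq by (cases p, cases q) (auto simp: liouville_map_def)
  have False if "u < v" "u \<in> X" "v \<in> X" "y (t, u) = y (t, v)" for u v
  proof -
    have uv: "w \<in> X" if "u \<le> w" "w \<le> v" for w
      using that TX(4) \<open>u \<in> X\<close> \<open>v \<in> X\<close> by (meson is_interval_1 is_interval_convex_1)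
    have der: "((\<lambda>z. y (t, z)) has_real_derivative \<rho> (t, w)) (at w)" if "u \<le> w" "w \<le> v" for w
      using smooth_on_has_partials(2)[OF y(1) open_S, of t w] y(2)[of "(t, w)"] uv[OF that] pq p by auto
    obtain w where "u < w" "w < v" "y (t, v) - y (t, u) = (v - u) * \<rho> (t, w)"
      using MVT2[OF \<open>u < v\<close> der] by blast
    with that \<rho>_nz[of "(t, w)"] uv[of w] pq p show False by auto
  qed
  from this[of x z] this[of z x] pq show "p = q"
    by (cases x z rule: linorder_cases) (auto simp: p liouville_map_def)
qed

lemma \<Psi>_\<Phi> [simp]: "p \<in> S \<Longrightarrow> \<Psi> (\<Phi> p) = p"
  by (simp add: \<Psi>_def inv_into_f_f[OF inj_liouville_map])

lemma \<Phi>_has_derivative: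
  assumes "p \<in> S"
  shows "(\<Phi> has_derivative (\<lambda>h. (fst h, D1 y p * fst h + \<rho> p * snd h))) (at p)"
proof -
  have "((\<lambda>p. (fst p, y p)) has_derivative (\<lambda>h. (fst h, D1 y p * fst h + D2 y p * snd h))) (at p)"
    by (intro has_derivative_Pair smooth_on_has_derivative[OF y(1) open_S assms] derivative_intros)
  moreover have "\<Phi> = (\<lambda>p. (fst p, y p))" by (auto simp: liouville_map_def)
  ultimately show ?thesis using y(2)[OF assms] by simp
qed

lemma open_image: "open (\<Phi> ` S)"
proof (rule invariance_of_domain[OF _ open_S inj_liouville_map])
  show "continuous_on S \<Phi>"
    using has_derivative_continuous[OF \<Phi>_has_derivative] by (intro continuous_at_imp_continuous_on) blast
qed

lemma \<Psi>_has_derivative: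
  assumes "p \<in> S"
  shows "(\<Psi> has_derivative (\<lambda>h. (fst h, (snd h - D1 y p * fst h) / \<rho> p))) (at (\<Phi> p))"
  by (rule has_derivative_inverse_on[OF open_S \<Phi>_has_derivative])
    (use assms \<rho>_nz[OF assms] in \<open>auto simp: fun_eq_iff\<close>)

text \<open>The transformation rules \<open>\<partial>_y = \<rho>^-1 \<partial>_x\<close> and
  \<open>\<partial>_\<tau> = \<partial>_t - (y_t / \<rho>) \<partial>_x\<close>.\<close>

lemma compose_has_derivative:
  assumes "p \<in> S" "(f has_derivative (\<lambda>h. f1 * fst h + f2 * snd h)) (at p)"
  shows "((\<lambda>q. f (\<Psi> q)) has_derivative
    (\<lambda>h. (f1 - f2 * D1 y p / \<rho> p) * fst h + f2 / \<rho> p * snd h)) (at (\<Phi> p))"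
proof -
  have "(f has_derivative (\<lambda>h. f1 * fst h + f2 * snd h)) (at (\<Psi> (\<Phi> p)))"
    using assms by simp
  from has_derivative_compose[OF \<Psi>_has_derivative[OF assms(1)] this] show ?thesis
    by (rule has_derivative_eq_rhs) (use \<rho>_nz[OF assms(1)] in \<open>auto simp: field_simps\<close>)
qed

text \<open>The transformed partials are again smooth fields on \<open>S\<close> composed with
  \<open>\<Psi>\<close>, so the induction runs over all smooth \<open>f\<close> at once.\<close>

lemma smooth_on_compose:
  assumes "smooth_on S f"
  shows "smooth_on (\<Phi> ` S) (\<lambda>q. f (\<Psi> q))"
proof -
  have "Ck_on k (\<Phi> ` S) (\<lambda>q. f (\<Psi> q))" for k
    using assms
  proof (induction k arbitrary: f)
    case 0
    have "((\<lambda>q. f (\<Psi> q)) has_derivative (\<lambda>h. (D1 f p - D2 f p * D1 y p / \<rho> p) * fst h + D2 f p / \<rho> p * snd h)) (at (\<Phi> p))"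
      if "p \<in> S" for p
      by (intro compose_has_derivative smooth_on_has_derivative[OF 0 open_S] that)
    then have "\<forall>q\<in>\<Phi> ` S. isCont (\<lambda>q. f (\<Psi> q)) q"
      using has_derivative_continuous by blast
    then show ?case by (simp add: continuous_at_imp_continuous_on)
  next
    case (Suc k)
    show ?case
    proof (rule Ck_on_SucI[OF open_image])
      fix q assume "q \<in> \<Phi> ` S"
      then obtain p where p: "p \<in> S" "q = \<Phi> p" by blast
      show "((\<lambda>q. f (\<Psi> q)) has_derivative
        (\<lambda>h. (D1 f (\<Psi> q) - D2 f (\<Psi> q) * D1 y (\<Psi> q) / \<rho> (\<Psi> q)) * fst h + D2 f (\<Psi> q) / \<rho> (\<Psi> q) * snd h)) (at q)"
        using compose_has_derivative[OF p(1) smooth_on_has_derivative[OF Suc.prems open_S p(1)]] p by simp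
    next
      show "Ck_on k (\<Phi> ` S) (\<lambda>q. D1 f (\<Psi> q) - D2 f (\<Psi> q) * D1 y (\<Psi> q) / \<rho> (\<Psi> q))"
        using Suc.prems \<rho> y(1) open_S
        by (intro Suc.IH[where f = "\<lambda>p. D1 f p - D2 f p * D1 y p / \<rho> p"] smooth_on_intros)
      show "Ck_on k (\<Phi> ` S) (\<lambda>q. D2 f (\<Psi> q) / \<rho> (\<Psi> q))"
        using Suc.prems \<rho> open_S
        by (intro Suc.IH[where f = "\<lambda>p. D2 f p / \<rho> p"] smooth_on_intros)
    qed
  qed
  then show ?thesis by (simp add: smooth_on_def)
qed

lemma D_compose:
  assumes "smooth_on S f" "p \<in> S"
  shows "D1 (\<lambda>q. f (\<Psi> q)) (\<Phi> p) = D1 f p - D2 f p * D1 y p / \<rho> p"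
    and "D2 (\<lambda>q. f (\<Psi> q)) (\<Phi> p) = D2 f p / \<rho> p"
  using partials_eqI[OF compose_has_derivative[OF assms(2) smooth_on_has_derivative[OF assms(1) open_S assms(2)]]]
  by simp_all

lemma smooth_liouville_Q: "smooth_on S (liouville_Q \<rho>)"
  unfolding liouville_Q_def
  by (intro smooth_on_intros open_S \<rho>) (use \<rho>_nz in auto)

lemma smooth_liouville_P: "smooth_on S (liouville_P m \<rho>)"
  unfolding liouville_P_def
  by (intro smooth_on_intros open_S \<rho> m) (use \<rho>_nz in auto)

section \<open>Transport of the recursion and of the flow to the new variables\<close>

lemma push_cong: "eq_on S v w \<Longrightarrow> eq_on (\<Phi> ` S) (push v) (push w)"
  by (auto simp: eq_on_def push_def)

lemma liouville_transform_QP: "liouville_transform S m \<rho> y Q P"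
proof -
  have "((\<lambda>\<xi>. y (t, \<xi>)) has_real_derivative \<rho> (t, x)) (at x)" if "(t, x) \<in> S" for t x
    using smooth_on_has_partials(2)[OF y(1) open_S that] y(2)[OF that] by simp
  then show ?thesis
    using y(1)
    by (auto simp: liouville_transform_def liouville_coord_def P_def Q_def liouville_P_def liouville_Q_def)
qed

lemma smooth_QP: "smooth_on (\<Phi> ` S) Q" "smooth_on (\<Phi> ` S) P"
  unfolding Q_def P_def
  using smooth_on_compose[OF smooth_liouville_Q] smooth_on_compose[OF smooth_liouville_P] by simp_all

text \<open>The intertwining relation. For \<open>v = \<K> (a, b)\<close> the second entry of
  \<open>push v\<close> is \<open>- (\<rho> a)_x / \<rho>\<close>, the \<open>y\<close>-derivative
  of \<open>- \<rho> a\<close>. Hence the preimage chosen under \<open>\<K>\<close> also fixes the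
  antiderivative demanded by \<open>Rbar\<close>. The first row is then the covariance identity, the
  second a direct computation.\<close>

lemma push_JKinv:
  assumes "(v, w) \<in> JKinv S m \<rho>"
  shows "(push v, push w) \<in> Rbar (\<Phi> ` S) Q P"
proof -
  from assms obtain a b where sm: "smooth_on S a" "smooth_on S b"
    and v: "eq_on S v (K_op m \<rho> (a, b))" and w: "eq_on S w (J_op (a, b))"
    by (rule JKinvE)
  define B where "B = (\<lambda>q. - (D2 \<rho> q * a q + \<rho> q * D2 a q) / \<rho> q)"
  have B: "smooth_on S B"
    unfolding B_def by (intro smooth_on_intros open_S \<rho> sm)
  have E: "smooth_on S (\<lambda>q. D2 B q / \<rho> q)"
    by (intro smooth_on_intros open_S \<rho> B)
  have \<beta>: "smooth_on S (\<lambda>p. - (\<rho> p * a p))"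
    by (intro smooth_on_intros open_S \<rho> sm)
  have D\<beta>: "D2 (\<lambda>p. - (\<rho> p * a p)) p = B p * \<rho> p" if p: "p \<in> S" for p
  proof -
    obtain t x where tx: "p = (t, x)" by (cases p)
    note has = smooth_on_has_partials(2)[OF _ open_S p[unfolded tx]]
    show ?thesis
      unfolding tx B_def
      by (rule D2_eqI, auto intro!: derivative_eq_intros has \<rho> sm)
        (use \<rho>_nz[OF p] tx in \<open>simp_all add: field_simps\<close>)
  qed
  have push_v: "snd (push v) (\<Phi> p) = B p"
      "fst (push v) (\<Phi> p) = (2 * m p * D2 a p + D2 m p * a p + \<rho> p * D2 b p) / (2 * (\<rho> p)\<^sup>2)" if p: "p \<in> S" for p
    using eq_onD[OF v p] K_op_eq[OF open_S p m \<rho>(1) sm(1), of b] p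
    by (simp_all add: push_def B_def diff_divide_distrib add_divide_distrib del: K_op.simps)
  \<comment> \<open>The second entry of \<open>push v\<close> is known only on the image of
    \<open>S\<close>; since the image is open, it may still be differentiated there.\<close>
  have D2_B: "D2 (snd (push v)) (\<Phi> p) = D2 B p / \<rho> p" if p: "p \<in> S" for p
  proof -
    have "D2 (snd (push v)) (\<Phi> p) = D2 (\<lambda>q. B (\<Psi> q)) (\<Phi> p)"
      by (rule D_cong(2)[OF open_image]) (use p push_v in auto)
    then show ?thesis using D_compose(2)[OF B p] by simp
  qed
  have D2_D2_B: "D2 (D2 (snd (push v))) (\<Phi> p) = D2 (\<lambda>q. D2 B q / \<rho> q) p / \<rho> p" if p: "p \<in> S" for p
  proof -
    have "D2 (D2 (snd (push v))) (\<Phi> p) = D2 (\<lambda>q. D2 B (\<Psi> q) / \<rho> (\<Psi> q)) (\<Phi> p)"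
      by (rule D_cong(2)[OF open_image]) (use p D2_B in auto)
    then show ?thesis using D_compose(2)[OF E p] by simp
  qed
  let ?\<beta> = "\<lambda>q. - (\<rho> (\<Psi> q) * a (\<Psi> q))"
  have "smooth_on (\<Phi> ` S) ?\<beta>"
    by (rule smooth_on_compose[OF \<beta>])
  moreover have "\<forall>q\<in>\<Phi> ` S. D2 ?\<beta> q = snd (push v) q"
    using D_compose(2)[OF \<beta>] D\<beta> \<rho>_nz push_v by auto
  moreover have "fst (push w) q = 1/2 * (D2 (D2 (snd (push v))) q + 4 * Q q * snd (push v) q + 2 * D2 Q q * ?\<beta> q)"
    "snd (push w) q = 1/2 * (- 4 * fst (push v) q + (4 * P q * snd (push v) q + 2 * D2 P q * ?\<beta> q))"
    if q: "q \<in> \<Phi> ` S" for q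
  proof -
    obtain p where p: "p \<in> S" "q = \<Phi> p" using q by blast
    have nz: "\<rho> p \<noteq> 0" using p \<rho>_nz by blast
    have "fst (push w) q = (D2 a p - D2 (D2 (D2 a)) p) / (2 * (\<rho> p)^2)"
      using eq_onD[OF w p(1)] p by (simp add: push_def)
    also have "\<dots> = 1/2 * (D2 (\<lambda>q. D2 B q / \<rho> q) p / \<rho> p + 4 * liouville_Q \<rho> p * B p
        - 2 * D2 (liouville_Q \<rho>) p * a p)"
      by (rule schwarzian_covariance[OF open_S p(1) \<rho> sm(1), symmetric]) (simp add: B_def)
    also have "\<dots> = 1/2 * (D2 (D2 (snd (push v))) q + 4 * Q q * snd (push v) q + 2 * D2 Q q * ?\<beta> q)"
      using D2_D2_B[OF p(1)] push_v(1)[OF p(1)] D_compose(2)[OF smooth_liouville_Q p(1)] p nz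
      by (simp add: Q_def)
    finally show "fst (push w) q = \<dots>" .
    have w2: "snd (push w) q = - D2 b p / \<rho> p"
      using eq_onD[OF w p(1)] p by (simp add: push_def)
    have P: "P q = - m p / (\<rho> p)\<^sup>2" using p by (simp add: P_def liouville_P_def)
    have DP: "D2 P q = (- D2 m p / (\<rho> p)\<^sup>2 + 2 * m p * D2 \<rho> p / (\<rho> p)^3) / \<rho> p"
      unfolding P_def p(2) D_compose(2)[OF smooth_liouville_P p(1)] liouville_P_partials(2)[OF open_S p(1) m \<rho>(1) nz] ..
    show "snd (push w) q = 1/2 * (- 4 * fst (push v) q + (4 * P q * snd (push v) q + 2 * D2 P q * ?\<beta> q))"
      unfolding w2 P DP unfolding p(2) push_v[OF p(1)] \<Psi>_\<Phi>[OF p(1)]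
      using nz by (simp add: B_def field_simps power2_eq_square eval_nat_numeral)
  qed
  ultimately show ?thesis
    unfolding Rbar_def by (cases "push v") (auto simp: eq_on_def)
qed

lemma push_JKinv_relpow: "(v, w) \<in> JKinv S m \<rho> ^^ k \<Longrightarrow> (push v, push w) \<in> Rbar (\<Phi> ` S) Q P ^^ k"
  by (induction k arbitrary: w) (auto intro: push_JKinv)

text \<open>The choice \<open>y_t = \<rho> a\<close> turns \<open>\<partial>_\<tau>\<close> into
  \<open>\<partial>_t - a \<partial>_x\<close>. Time derivatives are then eliminated by the flow
  equation, whose second row \<open>\<rho>_t = (\<rho> a)_x\<close> is differentiated in
  \<open>x\<close> up to twice after exchanging the order of derivatives.\<close>

lemma evolution:
  assumes sm: "smooth_on S a" "smooth_on S b" and flow: "eq_on S (D1 m, D1 \<rho>) (K_op m \<rho> (a, b))"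
    and y_t: "\<And>p. p \<in> S \<Longrightarrow> D1 y p = \<rho> p * a p"
  shows "eq_on (\<Phi> ` S) (D1 Q, D1 P) (push (J_op (a, b)))"
proof -
  have *: "D1 Q (\<Phi> p) = (D2 a p - D2 (D2 (D2 a)) p) / (2 * (\<rho> p)\<^sup>2) \<and> D1 P (\<Phi> p) = - D2 b p / \<rho> p"
    if p: "p \<in> S" for p
  proof -
    have nz: "\<rho> p \<noteq> 0" using p \<rho>_nz by blast
    have mt: "D1 m p = 2 * m p * D2 a p + D2 m p * a p + \<rho> p * D2 b p"
      using eq_onD(1)[OF flow p] K_op_eq(1)[OF open_S p m \<rho>(1) sm(1), of b] by (simp del: K_op.simps)
    have \<rho>t: "D1 \<rho> q = D2 \<rho> q * a q + \<rho> q * D2 a q" if "q \<in> S" for q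
      using eq_onD(2)[OF flow that] K_op_eq(2)[OF open_S that m \<rho>(1) sm(1), of b] by (simp del: K_op.simps)
    have \<rho>1t: "D1 (D2 \<rho>) q = D2 (D2 \<rho>) q * a q + 2 * D2 \<rho> q * D2 a q + \<rho> q * D2 (D2 a) q" if q: "q \<in> S" for q
    proof -
      obtain t x where tx: "q = (t, x)" by (cases q)
      note has = smooth_on_has_partials(2)[OF _ open_S q[unfolded tx]]
      have "D1 (D2 \<rho>) q = D2 (D1 \<rho>) q"
        using D1_D2_commute[OF TX \<rho>(1)] q tx by simp
      also have "\<dots> = D2 (\<lambda>q. D2 \<rho> q * a q + \<rho> q * D2 a q) q"
        by (rule D_cong(2)[OF open_S q \<rho>t])
      also have "\<dots> = D2 (D2 \<rho>) q * a q + 2 * D2 \<rho> q * D2 a q + \<rho> q * D2 (D2 a) q"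
        unfolding tx by (rule D2_eqI, auto intro!: derivative_eq_intros has smooth_on_D \<rho> sm)
      finally show ?thesis .
    qed
    have \<rho>2t: "D1 (D2 (D2 \<rho>)) p = D2 (D2 (D2 \<rho>)) p * a p + 3 * D2 (D2 \<rho>) p * D2 a p
      + 3 * D2 \<rho> p * D2 (D2 a) p + \<rho> p * D2 (D2 (D2 a)) p"
    proof -
      obtain t x where tx: "p = (t, x)" by (cases p)
      note has = smooth_on_has_partials(2)[OF _ open_S p[unfolded tx]]
      have "D1 (D2 (D2 \<rho>)) p = D2 (D1 (D2 \<rho>)) p"
        using D1_D2_commute[OF TX smooth_on_D(2)[OF \<rho>(1)]] p tx by simp
      also have "\<dots> = D2 (\<lambda>q. D2 (D2 \<rho>) q * a q + 2 * D2 \<rho> q * D2 a q + \<rho> q * D2 (D2 a) q) p"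
        by (rule D_cong(2)[OF open_S p \<rho>1t])
      also have "\<dots> = D2 (D2 (D2 \<rho>)) p * a p + 3 * D2 (D2 \<rho>) p * D2 a p
        + 3 * D2 \<rho> p * D2 (D2 a) p + \<rho> p * D2 (D2 (D2 a)) p"
        unfolding tx by (rule D2_eqI, auto intro!: derivative_eq_intros has smooth_on_D \<rho> sm)
      finally show ?thesis .
    qed
    have "D1 Q (\<Phi> p) = D1 (liouville_Q \<rho>) p - D2 (liouville_Q \<rho>) p * a p"
      using D_compose(1)[OF smooth_liouville_Q p] y_t[OF p] nz by (simp add: Q_def)
    also have "\<dots> = (D2 a p - D2 (D2 (D2 a)) p) / (2 * (\<rho> p)\<^sup>2)"
      unfolding liouville_Q_partials[OF open_S p \<rho>(1) nz] \<rho>t[OF p] \<rho>1t[OF p] \<rho>2t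
      using nz by (simp add: field_simps power2_eq_square eval_nat_numeral)
    finally have Q: "D1 Q (\<Phi> p) = \<dots>" .
    have "D1 P (\<Phi> p) = D1 (liouville_P m \<rho>) p - D2 (liouville_P m \<rho>) p * a p"
      using D_compose(1)[OF smooth_liouville_P p] y_t[OF p] nz by (simp add: P_def)
    also have "\<dots> = - D2 b p / \<rho> p"
      unfolding liouville_P_partials[OF open_S p m \<rho>(1) nz] mt \<rho>t[OF p]
      using nz by (simp add: field_simps power2_eq_square eval_nat_numeral)
    finally show ?thesis using Q by simp
  qed
  show ?thesis
    by (auto simp: eq_on_def push_def *)
qed

text \<open>Covariance with \<open>a = 1 / \<rho>\<close>: since \<open>\<rho> a\<close> is
  constant, only the \<open>Q_y\<close> term survives. The seed of the negative flows is thus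
  carried to the seed of the positive associated flows.\<close>

lemma push_translation:
  "eq_on (\<Phi> ` S) (push (J_op (\<lambda>p. 1 / \<rho> p, liouville_P m \<rho>))) (\<lambda>q. - D2 Q q, \<lambda>q. - D2 P q)"
proof -
  have "(D2 (\<lambda>p. 1 / \<rho> p) p - D2 (D2 (D2 (\<lambda>p. 1 / \<rho> p))) p) / (2 * (\<rho> p)^2) = - D2 Q (\<Phi> p)"
    if p: "p \<in> S" for p
  proof -
    have a: "smooth_on S (\<lambda>p. 1 / \<rho> p)" by (intro smooth_on_intros open_S \<rho>)
    have zero: "D2 (\<lambda>q. D2 (\<lambda>q. 0) q / \<rho> q) p = 0"
      by (simp add: D2_def split_beta)
    \<comment> \<open>The field \<open>B\<close> of the covariance identity is here the zero
      field.\<close>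
    have B: "0 = - (D2 \<rho> q * (1 / \<rho> q) + \<rho> q * D2 (\<lambda>p. 1 / \<rho> p) q) / \<rho> q" if q: "q \<in> S" for q
      using D2_inverse[OF open_S q \<rho>(1) \<rho>_nz[OF q]] \<rho>_nz[OF q]
      by (simp add: power2_eq_square)
    have "1/2 * (D2 (\<lambda>q. D2 (\<lambda>q. 0) q / \<rho> q) p / \<rho> p + 4 * liouville_Q \<rho> p * 0
      - 2 * D2 (liouville_Q \<rho>) p * (1 / \<rho> p)) =
      (D2 (\<lambda>p. 1 / \<rho> p) p - D2 (D2 (D2 (\<lambda>p. 1 / \<rho> p))) p) / (2 * (\<rho> p)^2)"
      by (rule schwarzian_covariance[OF open_S p \<rho> a B])
    then show ?thesis
      using D_compose(2)[OF smooth_liouville_Q p] zero by (simp add: Q_def)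
  qed
  then show ?thesis
    using D_compose(2)[OF smooth_liouville_P] by (auto simp: eq_on_def push_def P_def)
qed

end

section \<open>Transfer of solutions for every integer \<open>n\<close>\<close>

theorem theorem2p1:
  fixes n :: int and T X :: "real set" and m \<rho> :: field
  assumes "open T" "is_interval T" "open X" "is_interval X"
    and "solves_2CH (T \<times> X) (n + 1) m \<rho>"
  shows "\<exists>y Q P. liouville_transform (T \<times> X) m \<rho> y Q P \<and>
           solves_A2CH (liouville_map y ` (T \<times> X)) (- n) Q P"
proof -
  let ?S = "T \<times> X"
  have TX: "open T" "convex T" "open X" "convex X"
    using assms by (auto simp: is_interval_convex_1)
  have o: "open ?S" using TX by (simp add: open_Times)
  from assms(5) obtain F where sm: "smooth_on ?S m" "smooth_on ?S \<rho>" "\<forall>p\<in>?S. \<rho> p \<noteq> 0"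
    and F: "F \<in> flow_2CH ?S (n + 1) m \<rho>" "eq_on ?S (D1 m, D1 \<rho>) F"
    unfolding solves_2CH_def by blast
  let ?c = "(\<lambda>p. 1 / \<rho> p, liouville_P m \<rho>) :: vfield"
  have c: "smooth_on ?S (fst ?c)" "smooth_on ?S (snd ?c)"
    using sm o by (auto simp: liouville_P_def intro!: smooth_on_intros)
  \<comment> \<open>\<open>(a, b)\<close> is a preimage of \<open>(m, \<rho>)_t\<close> under
    \<open>\<K>\<close>, so \<open>w\<close> lies one step of \<open>JKinv\<close> beyond
    \<open>(m, \<rho>)_t\<close>.\<close>
  define W where "W a b w \<longleftrightarrow> smooth_on ?S a \<and> smooth_on ?S b \<and>
      eq_on ?S (D1 m, D1 \<rho>) (K_op m \<rho> (a, b)) \<and> eq_on ?S w (J_op (a, b))"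
    for a b :: field and w
  \<comment> \<open>The column \<open>w\<close> is joined to a known one: for
    \<open>n \<ge> 0\<close> it reaches zero in \<open>n\<close> steps, for \<open>n < 0\<close> it
    is reached from \<open>\<J> c\<close> in \<open>- n - 1\<close> steps.\<close>
  have "\<exists>a b w. W a b w \<and> (if n \<ge> 0 then (w, (\<lambda>p. 0, \<lambda>p. 0)) \<in> JKinv ?S m \<rho> ^^ nat n
      else (J_op ?c, w) \<in> JKinv ?S m \<rho> ^^ nat (- n - 1))"
  proof -
    consider "n \<ge> 0" | "n = -1" | "n < -1" by linarith
    then show ?thesis
    proof cases
      case 1
      let ?K1 = "(\<lambda>p. - D2 m p, \<lambda>p. - D2 \<rho> p)"
      have "(F, ?K1) \<in> JKinv ?S m \<rho> ^^ nat n"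
        using F(1) 1 by (auto simp: flow_2CH_def KJinv_relpow)
      moreover have "(?K1, (\<lambda>p. 0, \<lambda>p. 0)) \<in> JKinv ?S m \<rho>"
      proof (rule JKinvI[where a = "\<lambda>p. -1" and b = "\<lambda>p. 0"])
        have D0: "D2 (\<lambda>p. k) p = 0" for k p by (simp add: D2_def split_beta)
        show "eq_on ?S ?K1 (K_op m \<rho> (\<lambda>p. -1, \<lambda>p. 0))"
          using K_op_eq[OF o _ sm(1,2) smooth_on_const] by (simp add: eq_on_def D0 del: K_op.simps)
        have "D2 (\<lambda>p. k) = (\<lambda>p. 0)" for k by (rule ext) (rule D0)
        then show "eq_on ?S (\<lambda>p. 0, \<lambda>p. 0) (J_op (\<lambda>p. -1, \<lambda>p. 0))"
          by (simp add: eq_on_def)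
      qed (rule smooth_on_const)+
      \<comment> \<open>The chain gains a last step, from \<open>?K1\<close> to zero, and then gives
        up its first one, which provides \<open>a\<close>, \<open>b\<close> and
        \<open>w\<close>.\<close>
      ultimately have "(F, (\<lambda>p. 0, \<lambda>p. 0)) \<in> JKinv ?S m \<rho> ^^ Suc (nat n)"
        by (rule relpow_Suc_I)
      then obtain w where "(F, w) \<in> JKinv ?S m \<rho>" "(w, (\<lambda>p. 0, \<lambda>p. 0)) \<in> JKinv ?S m \<rho> ^^ nat n"
        by (rule relpow_Suc_E2)
      moreover from this(1) obtain a b where "smooth_on ?S a" "smooth_on ?S b"
        "eq_on ?S F (K_op m \<rho> (a, b))" "eq_on ?S w (J_op (a, b))"
        by (rule JKinvE)
      with F(2) have "W a b w" unfolding W_def using eq_on_trans by blast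
      ultimately show ?thesis using 1 by (intro exI[of _ a] exI[of _ b] exI[of _ w]) simp
    next
      case 2
      \<comment> \<open>The static flow of index 0. Taking \<open>c\<close> rather than zero as
        preimage gives \<open>y_t = 1\<close>, so that fields at rest in \<open>x\<close> become
        translations in \<open>y\<close>.\<close>
      have "F = (\<lambda>p. 0, \<lambda>p. 0)" using F(1) 2 by (simp add: flow_2CH_def)
      with F(2) have "eq_on ?S (D1 m, D1 \<rho>) (K_op m \<rho> ?c)"
        using eq_on_trans[OF _ eq_on_sym[OF K_op_kernel[OF o sm]]] by simp
      with c have "W (fst ?c) (snd ?c) (J_op ?c)" by (simp add: W_def eq_on_def)
      with 2 show ?thesis by (intro exI[of _ "fst ?c"] exI[of _ "snd ?c"] exI[of _ "J_op ?c"]) simp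
    next
      case 3
      \<comment> \<open>The flow index is \<open>n + 1\<close>, so \<open>F\<close> lies only
        \<open>- n - 2\<close> steps from \<open>\<J> c\<close>, and one step has to be
        appended.\<close>
      define j where "j = nat (- n - 2)"
      have j: "nat (- n - 1) = Suc j" "nat (- (n + 1) - 1) = j"
        using 3 by (simp_all add: j_def nat_eq_iff)
      \<comment> \<open>The chain defining the flow stops at \<open>F\<close>, so the preimage under
        \<open>\<K>\<close> comes from surjectivity.\<close>
      obtain a b where ab: "smooth_on ?S a" "smooth_on ?S b" "eq_on ?S (D1 m, D1 \<rho>) (K_op m \<rho> (a, b))"
        using K_op_surj[OF TX sm, of "(D1 m, D1 \<rho>)"] sm(1,2)
        by (metis fst_conv snd_conv smooth_on_D(1))
      have "(J_op ?c, F) \<in> JKinv ?S m \<rho> ^^ j"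
        using F(1) 3 j by (simp add: flow_2CH_def liouville_P_def)
      moreover have "(F, J_op (a, b)) \<in> JKinv ?S m \<rho>"
        by (rule JKinvI[OF ab(1,2)]) (use ab(3) F(2) eq_on_sym eq_on_trans in blast, simp add: eq_on_def)
      ultimately have "(J_op ?c, J_op (a, b)) \<in> JKinv ?S m \<rho> ^^ nat (- n - 1)"
        unfolding j by (rule relpow_Suc_I)
      moreover have "W a b (J_op (a, b))"
        using ab by (simp add: W_def eq_on_def del: K_op.simps J_op.simps)
      ultimately show ?thesis
        using 3 by (intro exI[of _ a] exI[of _ b] exI[of _ "J_op (a, b)"]) (simp del: J_op.simps)
    qed
  qed
  then obtain a b w where W: "W a b w"
    and w: "if n \<ge> 0 then (w, (\<lambda>p. 0, \<lambda>p. 0)) \<in> JKinv ?S m \<rho> ^^ nat n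
      else (J_op ?c, w) \<in> JKinv ?S m \<rho> ^^ nat (- n - 1)"
    by blast
  have ab: "smooth_on ?S a" "smooth_on ?S b" "eq_on ?S (D1 m, D1 \<rho>) (K_op m \<rho> (a, b))" "eq_on ?S w (J_op (a, b))"
    using W by (simp_all add: W_def)
  \<comment> \<open>The second row of the flow, \<open>\<rho>_t = (\<rho> a)_x\<close>, is the
    integrability condition for \<open>y_x = \<rho>\<close> and \<open>y_t = \<rho> a\<close>.
    Prescribing \<open>y_t\<close> removes the time-dependent freedom in \<open>y\<close>.\<close>
  obtain y where potential: "smooth_on ?S y"
    "\<And>p. p \<in> ?S \<Longrightarrow> D1 y p = \<rho> p * a p" "\<And>p. p \<in> ?S \<Longrightarrow> D2 y p = \<rho> p"
    using smooth_potential[OF TX sm(2) smooth_on_mult[OF o sm(2) ab(1)]] ab(3)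
    by (auto simp: eq_on_def)
  interpret liouville T X m \<rho> y
    using TX sm potential by unfold_locales auto
  have ev: "eq_on (\<Phi> ` ?S) (D1 Q, D1 P) (push w)"
    using evolution[OF ab(1-3) potential(2)]
      push_cong[OF eq_on_sym[OF ab(4)]]
    by (rule eq_on_trans)
  have "solves_A2CH (\<Phi> ` ?S) (- n) Q P"
  proof (cases "n \<ge> 0")
    case True
    with w have "(push w, push (\<lambda>p. 0, \<lambda>p. 0)) \<in> Rbar (\<Phi> ` ?S) Q P ^^ nat n"
      by (simp add: push_JKinv_relpow)
    \<comment> \<open>The transported chain starts at \<open>push w\<close>, which agrees with
      \<open>(D1 Q, D1 P)\<close> only on the image, so its start is exchanged.\<close>
    then obtain w' where w': "((D1 Q, D1 P), w') \<in> Rbar (\<Phi> ` ?S) Q P ^^ nat n"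
      "eq_on (\<Phi> ` ?S) (push (\<lambda>p. 0, \<lambda>p. 0)) w'"
      by (rule Rbar_relpow_cong[OF open_image _ eq_on_sym[OF ev]])
    have "eq_on (\<Phi> ` ?S) w' (\<lambda>p. 0, \<lambda>p. 0)"
      using w'(2) by (simp add: eq_on_def push_def)
    with w'(1) True show ?thesis
      using open_image smooth_QP by (auto simp: solves_A2CH_def)
  next
    case False
    with w have "(push (J_op ?c), push w) \<in> Rbar (\<Phi> ` ?S) Q P ^^ nat (- n - 1)"
      by (simp add: push_JKinv_relpow)
    \<comment> \<open>Here the chain runs the other way, from the translation flow to
      \<open>push w\<close>, and its length \<open>- n - 1\<close> is the exponent required for
      index \<open>- n\<close>.\<close>
    then obtain w' where w': "((\<lambda>q. - D2 Q q, \<lambda>q. - D2 P q), w') \<in> Rbar (\<Phi> ` ?S) Q P ^^ nat (- n - 1)"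
      "eq_on (\<Phi> ` ?S) (push w) w'"
      by (rule Rbar_relpow_cong[OF open_image _ push_translation])
    with ev eq_on_trans have "eq_on (\<Phi> ` ?S) (D1 Q, D1 P) w'" by blast
    with w'(1) False show ?thesis
      using open_image smooth_QP by (auto simp: solves_A2CH_def)
  qed
  with liouville_transform_QP show ?thesis by blast
qed

end
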